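(* Let $n\ge2$, $p\in\{2,\dots,n\}$, $c,d,\sigma\in\mathbb{R}$, let $M,K$ be symmetric positive definite $n\times n$ real matrices, and let $\omega_k>0$, $\phi_k\in\mathbb{R}^n$ $(k=1,\dots,n)$ satisfy $K\phi_k=\omega_k^2M\phi_k$ and $\phi_k^TM\phi_l=\delta_{kl}$. Let $\lambda_k>0$, $f_k\in\mathbb{R}$ and $\tilde\omega_\epsilon=\omega_1+\epsilon\sigma$. Assume that, for each $k\ne1$, $\omega_k$ and $\omega_1$ are $\mathbb{Z}$-independent. Let $(\bar a_1,\bar\beta_1)$, $\bar a_1\neq 0$, be a stationary solution of $$\omega_1\Bigl(2\frac{da_1}{dT_1}+\lambda_1a_1\Bigr)=-f_1\sin\beta_1,\qquad2\omega_1\Bigl(a_1\frac{d\beta_1}{dT_1}+\sigma a_1\Bigr)=\frac{3d\,a_1^3}{4}(\delta_p\phi_1)^4-f_1\cos\beta_1. \tag{S}$$ For small $\epsilon>0$ let $(y_1,\dots,y_n)$ be the solution of $$\ddot y_k+\epsilon\lambda_k\dot y_k+\omega_k^2y_k+\delta_p\phi_k\left[c\Bigl(\sum_{i=1}^ny_i\,\delta_p\phi_i\Bigr)^2+\frac{d}{\epsilon}\Bigl(\sum_{i=1}^ny_i\,\delta_p\phi_i\Bigr)^3\right]=\epsilon^2f_k\cos(\tilde\omega_\epsilon t),\quad k=1,\dots,n,$$ with initial data $$y_1(0)=\epsilon a_{1,0}\cos(\beta_{1,0})+O(\epsilon^2),\quad\dot y_1(0)=-\epsilon\omega_1a_{1,0}\sin(\beta_{1,0})+O(\epsilon^2),\quad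 y_k(0)=O(\epsilon^2),\quad\dot y_k(0)=0\ (k\ne1),$$ close to the stationary solution: $|a_{1,0}-\bar a_1|\le\epsilon C_1$, $|\beta_{1,0}-\bar\beta_1|\le\epsilon C_1$ for a constant $C_1$ independent of $\epsilon$. Then there exists $\gamma>0$ such that, for all sufficiently small $\epsilon>0$ and all $0\le t\le t_\epsilon=\frac{\gamma}{\epsilon}$, $$y_1(t)=\epsilon a_1(\epsilon t)\cos\bigl(\tilde\omega_\epsilon t+\beta_1(\epsilon t)\bigr)+\epsilon^2r_1(\epsilon,t),\qquad y_k(t)=\epsilon^2r_k(\epsilon,t)\ (k\neq1),$$ where $(a_1,\beta_1)$ is the solution of (S) with $a_1(0)=a_{1,0}$, $\beta_1(0)=\beta_{1,0}$, and $r_k(\epsilon,\cdot)$ is uniformly bounded in $C^2(0,t_\epsilon)$ for $k=1,\dots,n$.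
   Context: $T_1=\epsilon t$ is the slow time; a stationary solution of (S) is a constant solution. $\phi_{k,j}$ is the $j$-th component of $\phi_k$ and $\delta_p\phi_k=\phi_{k,p}-\phi_{k,p-1}$. $\mathbb{Z}$-independence of $\omega_k$ and $\omega_1$ means that $m\omega_k+q\omega_1=0$ with $m,q\in\mathbb{Z}$ forces $m=q=0$. The system is the equation $M\ddot u+\epsilon C\dot u+Ku+\Phi(u,\epsilon)=\epsilon^2F\cos(\tilde\omega_\epsilon t)$ written in the basis of generalized eigenvectors, $u=\sum_ky_k\phi_k$, with $C$ diagonal in this basis ($\phi_k^TC\phi_l=\lambda_k\delta_{kl}$), $f_k=\phi_k^TF$, and all components of $\Phi$ zero except $\Phi_p(u,\epsilon)=c(u_p-u_{p-1})^2+\frac d\epsilon(u_p-u_{p-1})^3$ and $\Phi_{p-1}=-\Phi_p$. "Uniformly bounded in $C^2(0,t_\epsilon)$" means that $|r_k|,|\partial_tr_k|,|\partial_t^2r_k|$ are bounded on $(0,t_\epsilon)$ by a constant independent of $\epsilon$. *)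

theory Defs
  imports
    "HOL-Analysis.Analysis"
    "HOL-Library.Landau_Symbols"
    "Jordan_Normal_Form.Matrix"
begin

no_notation inner (infix "\<bullet>" 70)
no_notation vec_nth (infixl "$" 90)
hide_type (open) Finite_Cartesian_Product.vec

definition sym_pos_def :: "nat \<Rightarrow> real mat \<Rightarrow> bool" where
  "sym_pos_def n A \<longleftrightarrow> A \<in> carrier_mat n n \<and> transpose_mat A = A \<and>
     (\<forall>v \<in> carrier_vec n. v \<noteq> 0\<^sub>v n \<longrightarrow> 0 < v \<bullet> (A *\<^sub>v v))"

definition Z_independent :: "real \<Rightarrow> real \<Rightarrow> bool" where
  "Z_independent x y \<longleftrightarrow> (\<forall>m q :: int. of_int m * x + of_int q * y = 0 \<longrightarrow> m = 0 \<and> q = 0)"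

text \<open>The components of a vector are numbered from 1 in the mathematics and from 0 in the type
  of vectors: component \<open>p\<close> of \<open>v\<close> is \<open>v $ (p - 1)\<close>. This is meant for \<open>p \<ge> 2\<close>.\<close>

definition jump :: "nat \<Rightarrow> real vec \<Rightarrow> real" where
  "jump p v = v $ (p - 1) - v $ (p - 2)"

text \<open>System (S) on the interval \<open>I\<close> of slow time; the arguments \<open>\<omega>\<close>, \<open>lam\<close>, \<open>f\<close>, \<open>\<delta>\<close> stand for
  \<open>\<omega>\<^sub>1\<close>, \<open>\<lambda>\<^sub>1\<close>, \<open>f\<^sub>1\<close> and the jump of the first eigenvector. Derivatives are one-sided at end points
  belonging to \<open>I\<close>.\<close>

definition modulation_solution ::
  "real \<Rightarrow> real \<Rightarrow> real \<Rightarrow> real \<Rightarrow> real \<Rightarrow> real \<Rightarrow> real set \<Rightarrow>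
    (real \<Rightarrow> real) \<Rightarrow> (real \<Rightarrow> real) \<Rightarrow> bool" where
  "modulation_solution \<omega> lam f \<sigma> d \<delta> I a b \<longleftrightarrow>
     (\<exists>a' b'. \<forall>s\<in>I.
        (a has_real_derivative a' s) (at s within I) \<and>
        (b has_real_derivative b' s) (at s within I) \<and>
        \<omega> * (2 * a' s + lam * a s) = - f * sin (b s) \<and>
        2 * \<omega> * (a s * b' s + \<sigma> * a s) = 3 * d * a s ^ 3 / 4 * \<delta> ^ 4 - f * cos (b s))"

text \<open>\<open>y\<close> solves the \<open>n\<close> modal equations on \<open>{0..T}\<close>, with \<open>D k\<close> the jump of the \<open>k\<close>-th eigenvector,
  \<open>\<Omega>\<close> the forcing frequency, and \<open>Y0 k\<close>, \<open>V0 k\<close> the initial position and velocity of mode \<open>k\<close>.\<close>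

definition modal_solution ::
  "nat \<Rightarrow> (nat \<Rightarrow> real) \<Rightarrow> (nat \<Rightarrow> real) \<Rightarrow> (nat \<Rightarrow> real) \<Rightarrow> (nat \<Rightarrow> real) \<Rightarrow> real \<Rightarrow> real \<Rightarrow>
    real \<Rightarrow> real \<Rightarrow> (nat \<Rightarrow> real) \<Rightarrow> (nat \<Rightarrow> real) \<Rightarrow> real \<Rightarrow> (nat \<Rightarrow> real \<Rightarrow> real) \<Rightarrow> bool" where
  "modal_solution n \<omega> lam f D c d \<epsilon> \<Omega> Y0 V0 T y \<longleftrightarrow>
     (\<exists>y' y''. \<forall>k\<in>{1..n}.
        y k 0 = Y0 k \<and> y' k 0 = V0 k \<and>
        (\<forall>t\<in>{0..T}.
          (y k has_real_derivative y' k t) (at t within {0..T}) \<and>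
          (y' k has_real_derivative y'' k t) (at t within {0..T}) \<and>
          y'' k t + \<epsilon> * lam k * y' k t + (\<omega> k)\<^sup>2 * y k t
            + D k * (c * (\<Sum>i=1..n. y i t * D i)\<^sup>2 + d / \<epsilon> * (\<Sum>i=1..n. y i t * D i) ^ 3)
          = \<epsilon>\<^sup>2 * f k * cos (\<Omega> * t)))"

definition C2_bounded_by :: "real \<Rightarrow> real set \<Rightarrow> (real \<Rightarrow> real) \<Rightarrow> bool" where
  "C2_bounded_by B S r \<longleftrightarrow>
     (\<exists>r' r''. continuous_on S r'' \<and>
        (\<forall>t\<in>S. (r has_real_derivative r' t) (at t) \<and> (r' has_real_derivative r'' t) (at t) \<and>
               \<bar>r t\<bar> \<le> B \<and> \<bar>r' t\<bar> \<le> B \<and> \<bar>r'' t\<bar> \<le> B))"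

end

theory Submission
  imports Defs
begin

text \<open>
  With \<open>y\<^sub>k = \<epsilon> x\<^sub>k\<close>, the rotating amplitudes \<open>w\<^sub>k = exp (- \<i> \<omega>\<^sub>k t) (x\<^sub>k' + \<i> \<omega>\<^sub>k x\<^sub>k)\<close> satisfy
  \<open>w\<^sub>k' = \<epsilon> exp (- \<i> \<omega>\<^sub>k t) g\<^sub>k (t, w)\<close> with a polynomial force \<open>g\<^sub>k\<close>, so over a time \<open>\<gamma> / \<epsilon>\<close> they move by
  \<open>O(\<gamma>)\<close> only. System (S) says precisely that \<open>B (t) = \<i> \<omega>\<^sub>1 a\<^sub>1 (\<epsilon> t) exp (\<i> (\<sigma> \<epsilon> t + \<beta>\<^sub>1 (\<epsilon> t)))\<close> solves
  \<open>B' = \<epsilon> h (t, B)\<close>, where \<open>h\<close> is the resonant part of \<open>exp (- \<i> \<omega>\<^sub>1 t) g\<^sub>1 (t, (B, 0, \<dots>, 0))\<close>. All the other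
  harmonics have nonzero frequencies \<open>j \<omega>\<^sub>1 - \<omega>\<^sub>k\<close>, \<open>\<bar>j\<bar> \<le> 3\<close>, and slowly varying coefficients, hence
  primitives bounded uniformly in \<open>\<epsilon>\<close>. Subtracting these primitives turns the equation for
  \<open>e = w - (B, 0, \<dots>, 0)\<close> into \<open>e' = O(\<epsilon> \<bar>e\<bar>) + O(\<epsilon>\<^sup>2)\<close>, and \<open>e = O(\<epsilon>)\<close> follows on \<open>[0, \<gamma> / \<epsilon>]\<close>. As
  \<open>\<gamma>\<close> may be taken small, a contraction argument replaces both Gronwall's inequality and
  the continuation of solutions.
\<close>

text \<open>The coefficient \<open>d / \<epsilon>\<close> fixes the scaling: with
  \<open>y\<^sub>k = \<epsilon> x\<^sub>k\<close> the damping, the forcing, the quadratic and the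
  cubic term all carry one and the same factor \<epsilon>, so that a single slow time is enough. The
  square of a mode-1 oscillation has only the harmonics 0, 2 and -2, hence \<open>c\<close> is
  absent from (S); the forcing, the damping and the part \<open>\<bar>B\<bar>\<^sup>2 B\<close> of
  the cube are what resonates with mode 1.

  The obstacle is uniformity. The interval becomes infinitely long as \<epsilon> tends to 0, and a
  nonresonant term estimated by its size alone would cost O(1). Every constant has to be chosen
  before \<epsilon>, the interval and the solutions; the predicates \<open>slow\<close>,
  \<open>small_primitive\<close> and \<open>slow_op\<close> keep track of this order of choices.

  The comparison takes place between complex amplitudes because there the equations are polynomial.
  The polar form (S), solved for the derivatives, divides by the amplitude, and
  \<open>abar \<noteq> 0\<close> keeps it regular near the initial data.\<close>

declare One_nat_def [simp del]

section \<open>Picard iteration and trapping on a ball\<close>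

text \<open>All components form one bounded continuous function on \<open>nat \<times> real\<close>,
  whose sup norm is the supremum over components and times; a finite system is padded with
  components whose right-hand side is 0. \<open>M * T \<le> R\<close> keeps the ball invariant and
  \<open>L * T < 1\<close> makes the integral operator a contraction in this norm. The lemma serves
  both (S) and the modal system.\<close>

lemma picard_on_ball:
  fixes F :: "nat \<Rightarrow> real \<Rightarrow> (nat \<Rightarrow> 'b::banach) \<Rightarrow> 'b" and w0 :: "nat \<Rightarrow> 'b"
  assumes T: "0 \<le> T" and R: "0 \<le> R" and L: "0 \<le> L"
    and cont: "\<And>k W. (\<And>i. continuous_on {0..T} (W i)) \<Longrightarrow>
                 (\<And>i s. s \<in> {0..T} \<Longrightarrow> norm (W i s - w0 i) \<le> R) \<Longrightarrow>
                 continuous_on {0..T} (\<lambda>s. F k s (\<lambda>i. W i s))"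
    and bnd: "\<And>k s w. s \<in> {0..T} \<Longrightarrow> (\<And>i. norm (w i - w0 i) \<le> R) \<Longrightarrow> norm (F k s w) \<le> M"
    and lip: "\<And>k s w v e. s \<in> {0..T} \<Longrightarrow> (\<And>i. norm (w i - w0 i) \<le> R) \<Longrightarrow>
                 (\<And>i. norm (v i - w0 i) \<le> R) \<Longrightarrow> (\<And>i. norm (w i - v i) \<le> e) \<Longrightarrow>
                 norm (F k s w - F k s v) \<le> L * e"
    and MT: "M * T \<le> R" and LT: "L * T < 1"
  obtains W where "\<And>k. W k 0 = w0 k"
    and "\<And>k t. t \<in> {0..T} \<Longrightarrow> (W k has_vector_derivative F k t (\<lambda>i. W i t)) (at t within {0..T})"
    and "\<And>k t. t \<in> {0..T} \<Longrightarrow> norm (W k t - w0 k) \<le> R"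
proof -
  define S where "S = {v :: (nat \<times> real) \<Rightarrow>\<^sub>C 'b. \<forall>x. norm (apply_bcontfun v x) \<le> R}"
  \<comment> \<open>Clamping the time to \<open>{0..T}\<close> makes the iterates total functions on
    the real line, constant outside the interval.\<close>
  define cl where "cl t = max 0 (min T t)" for t
  have cl: "cl t \<in> {0..T}" for t
    using T by (auto simp: cl_def)
  have cl_id: "cl t = t" if "t \<in> {0..T}" for t
    using that by (auto simp: cl_def)
  have cont_cl: "continuous_on A cl" for A
    unfolding cl_def by (intro continuous_intros)
  define G where "G v k s = F k s (\<lambda>i. w0 i + apply_bcontfun v (i, s))" for v k s
  have G_cont: "continuous_on {0..T} (G v k)" if "v \<in> S" for v k
    unfolding G_def
  proof (rule cont)
    show "continuous_on {0..T} (\<lambda>s. w0 i + apply_bcontfun v (i, s))" for i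
      by (intro continuous_intros continuous_on_compose2[OF continuous_on_apply_bcontfun[of UNIV v]]) auto
    show "norm (w0 i + apply_bcontfun v (i, s) - w0 i) \<le> R" for i s
      using that by (auto simp: S_def)
  qed
  have G_bnd: "norm (G v k s) \<le> M" if "v \<in> S" "s \<in> {0..T}" for v k s
    unfolding G_def using that by (intro bnd) (auto simp: S_def)
  have G_int: "G v k integrable_on {0..t}" if "v \<in> S" "t \<in> {0..T}" for v k t
    using that by (intro integrable_continuous_interval continuous_on_subset[OF G_cont]) auto
  define P where "P v = (\<lambda>(k, t). integral {0..cl t} (G v k))" for v
  have M0: "0 \<le> M"
    using order_trans[OF norm_ge_zero bnd[of 0 w0 0]] T R by simp
  have P_bnd: "norm (P v x) \<le> R" if "v \<in> S" for v x
  proof (cases x)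
    case (Pair k t)
    have "norm (integral {0..cl t} (G v k)) \<le> M * (cl t - 0)"
      by (intro integral_bound continuous_on_subset[OF G_cont[OF that]])
         (use cl[of t] G_bnd[OF that] in auto)
    also have "\<dots> \<le> M * T"
      using cl[of t] M0 by (auto intro: mult_left_mono)
    finally show ?thesis
      using MT Pair by (simp add: P_def)
  qed
  have P_in: "P v \<in> bcontfun" if "v \<in> S" for v
    unfolding bcontfun_def
  proof safe
    have c: "continuous_on UNIV (\<lambda>t. P v (k, t))" for k
      unfolding P_def split_def fst_conv snd_conv
      by (rule continuous_on_compose2[OF indefinite_integral_continuous_1[OF G_int[OF that]] cont_cl])
         (use cl T in auto)
    show "continuous_on UNIV (P v)"
      unfolding continuous_on_open_vimage[OF open_UNIV]
    proof safe
      fix B :: "'b set" assume B: "open B"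
      \<comment> \<open>\<open>nat\<close> is discrete, so an open set of pairs may be assembled
        from one slice for each component, and continuity in time suffices.\<close>
      have "P v -` B \<inter> UNIV = (\<Union>k. {k} \<times> ((\<lambda>t. P v (k, t)) -` B \<inter> UNIV))"
        by auto
      also have "open \<dots>"
        using c B unfolding continuous_on_open_vimage[OF open_UNIV]
        by (intro open_UN ballI open_Times open_discrete) blast+
      finally show "open (P v -` B \<inter> UNIV)" .
    qed
    show "bounded (range (P v))"
      using P_bnd[OF that] by (auto simp: bounded_iff)
  qed
  define Q where "Q v = Bcontfun (P v)" for v
  have Q: "apply_bcontfun (Q v) = P v" if "v \<in> S" for v
    unfolding Q_def using P_in[OF that] by (simp add: Bcontfun_inverse)
  \<comment> \<open>The library provides completeness of \<open>bcontfun\<close> only over metric domains, and \<open>nat\<close> is not one.\<close>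
  have complete: "complete S"
    unfolding complete_def
  proof (intro allI impI, elim conjE)
    fix v assume v: "\<forall>n. v n \<in> S" and "Cauchy v"
    then have "uniformly_Cauchy_on UNIV (\<lambda>n. apply_bcontfun (v n))"
      unfolding Cauchy_def uniformly_Cauchy_on_def by (meson dist_fun_lt_imp_dist_val_lt)
    then obtain g where "uniform_limit UNIV (\<lambda>n. apply_bcontfun (v n)) g sequentially"
      using Cauchy_uniformly_convergent unfolding uniformly_convergent_on_def by blast
    then obtain l where lim: "v \<longlonglongrightarrow> l"
      using uniform_limit_bcontfunE[OF _ sequentially_bot] by metis
    have "norm (apply_bcontfun l x) \<le> R" for x
    proof (rule Lim_norm_ubound[OF sequentially_bot])
      show "(\<lambda>n. apply_bcontfun (v n) x) \<longlonglongrightarrow> apply_bcontfun l x"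
        using tendsto_uniform_limitI[OF tendsto_bcontfun_uniform_limit[OF lim]] by auto
      show "\<forall>\<^sub>F n in sequentially. norm (apply_bcontfun (v n) x) \<le> R"
        using v unfolding S_def by (intro always_eventually) blast
    qed
    then show "\<exists>l\<in>S. v \<longlonglongrightarrow> l"
      using lim by (auto simp: S_def)
  qed
  have "\<exists>!v\<in>S. Q v = v"
  proof (rule Banach_fix)
    show "complete S"
      by (rule complete)
    have "const_bcontfun 0 \<in> S"
      using R by (auto simp: S_def const_bcontfun.rep_eq)
    then show "S \<noteq> {}" by blast
    show "0 \<le> L * T" "L * T < 1" using T L LT by auto
    show "Q ` S \<subseteq> S"
      using P_bnd Q by (auto simp: S_def)
    fix u v assume uv: "u \<in> S" "v \<in> S"
    show "dist (Q u) (Q v) \<le> L * T * dist u v"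
    proof (rule dist_bound)
      fix x :: "nat \<times> real"
      obtain k t where x: "x = (k, t)" by fastforce
      \<comment> \<open>\<open>dist u v\<close> bounds the difference in every component at once,
        which is the common bound \<open>e\<close> that \<open>lip\<close> requires.\<close>
      have diff: "norm (G u k s - G v k s) \<le> L * dist u v" if "s \<in> {0..T}" for s
        unfolding G_def using uv that dist_bounded[of u _ v]
        by (intro lip) (auto simp: S_def dist_norm)
      have "dist (P u x) (P v x) = norm (integral {0..cl t} (\<lambda>s. G u k s - G v k s))"
        using G_int[OF uv(1) cl] G_int[OF uv(2) cl] by (simp add: x P_def dist_norm integral_diff)
      also have "\<dots> \<le> (L * dist u v) * (cl t - 0)"
        by (intro integral_bound continuous_intros
              continuous_on_subset[OF G_cont[OF uv(1)]] continuous_on_subset[OF G_cont[OF uv(2)]])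
           (use cl[of t] diff in auto)
      also have "\<dots> \<le> (L * dist u v) * T"
        using cl[of t] L by (intro mult_left_mono) auto
      finally show "dist (apply_bcontfun (Q u) x) (apply_bcontfun (Q v) x) \<le> L * T * dist u v"
        using Q uv by (simp add: mult_ac)
    qed
  qed
  then obtain v where v: "v \<in> S" "Q v = v" by blast
  define W where "W k t = w0 k + apply_bcontfun v (k, t)" for k t
  have W: "W k t = w0 k + integral {0..t} (G v k)" if "t \<in> {0..T}" for k t
  proof -
    have "apply_bcontfun v (k, t) = P v (k, t)"
      using Q[OF v(1)] v(2) by simp
    then show ?thesis using cl_id[OF that] by (simp add: W_def P_def)
  qed
  show ?thesis
  proof
    show "W k 0 = w0 k" for k
      using W[of 0 k] T by simp
    fix k t assume t: "t \<in> {0..T}"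
    have der: "((\<lambda>u. w0 k + integral {0..u} (G v k)) has_vector_derivative G v k t) (at t within {0..T})"
      by (rule derivative_eq_intros integral_has_vector_derivative[OF G_cont[OF v(1)] t] refl)+ simp
    have "(W k has_vector_derivative G v k t) (at t within {0..T})"
      by (rule has_vector_derivative_transform[OF t W der])
    then show "(W k has_vector_derivative F k t (\<lambda>i. W i t)) (at t within {0..T})"
      by (simp add: G_def W_def[abs_def])
    show "norm (W k t - w0 k) \<le> R"
      using v(1) by (simp add: S_def W_def)
  qed
qed

text \<open>First exit argument. The bound on the derivatives is available only while all components
  are within \<open>R\<close> of their start, and up to the first time at which one of them reaches
  \<open>R\<close> it yields a displacement of at most \<open>M * T < R\<close>. This gives a priori
  bounds for solutions that are merely assumed to exist.\<close>

lemma bootstrap_ball: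
  fixes W :: "'i \<Rightarrow> real \<Rightarrow> 'b::real_normed_vector"
  assumes I: "finite I" and T: "0 \<le> T"
    and der: "\<And>k t. k \<in> I \<Longrightarrow> t \<in> {0..T} \<Longrightarrow>
                (W k has_vector_derivative W' k t) (at t within {0..T})"
    and bnd: "\<And>k t. k \<in> I \<Longrightarrow> t \<in> {0..T} \<Longrightarrow> (\<And>i. i \<in> I \<Longrightarrow> norm (W i t - W i 0) \<le> R) \<Longrightarrow>
                norm (W' k t) \<le> M"
    and M: "0 \<le> M" "M * T < R"
    and k: "k \<in> I" and t: "t \<in> {0..T}"
  shows "norm (W k t - W k 0) < R"
proof (rule ccontr)
  assume contr: "\<not> norm (W k t - W k 0) < R"
  have W_cont: "continuous_on {0..T} (W i)" if "i \<in> I" for i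
    using der[OF that] by (rule continuous_on_vector_derivative)
  \<comment> \<open>The times at which some component has left the open ball form a finite union of
    closed sets, so there is a first one.\<close>
  define Z where "Z = (\<Union>i\<in>I. {s \<in> {0..T}. R \<le> norm (W i s - W i 0)})"
  have "closed Z"
    unfolding Z_def using I
    by (intro closed_UN ballI continuous_on_closed_Collect_le continuous_intros W_cont) auto
  then have "compact ({0..T} \<inter> Z)"
    by (intro compact_Int_closed compact_Icc)
  moreover have "{0..T} \<inter> Z = Z"
    by (auto simp: Z_def)
  ultimately have "compact Z"
    by simp
  moreover have "Z \<noteq> {}"
    using contr k t by (auto simp: Z_def not_less)
  ultimately obtain s where s: "s \<in> Z" and s_min: "\<And>u. u \<in> Z \<Longrightarrow> s \<le> u"
    using compact_attains_inf[of Z] by blast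
  then obtain i where i: "i \<in> I" "R \<le> norm (W i s - W i 0)" and s01: "s \<in> {0..T}"
    by (auto simp: Z_def)
  have small: "norm (W j u - W j 0) \<le> R" if "j \<in> I" "0 < u" "u < s" for j u
    using s_min[of u] that s01 by (force simp: Z_def not_le)
  have "s \<noteq> 0"
    using i M T by (smt (verit) diff_self norm_zero mult_nonneg_nonneg)
  with s01 have "0 < s" by auto
  have "norm (W i s - W i 0) \<le> M * s - M * 0"
  proof (rule differentiable_bound_general[where \<phi>' = "\<lambda>_. M"])
    show "0 < s" by fact
    show "continuous_on {0..s} (W i)"
      by (rule continuous_on_subset[OF W_cont[OF i(1)]]) (use s01 in auto)
    show "continuous_on {0..s} ((*) M)"
      by (intro continuous_intros)
    fix u assume u: "0 < u" "u < s"
    then show "(W i has_vector_derivative W' i u) (at u)"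
      using der[OF i(1), of u] s01 by (simp add: at_within_Icc_at)
    show "((*) M has_vector_derivative M) (at u)"
      by (auto intro!: derivative_eq_intros)
    show "norm (W' i u) \<le> M"
      using u s01 small by (intro bnd i) auto
  qed
  also have "\<dots> \<le> M * T"
    using s01 M by (auto intro: mult_left_mono)
  finally show False
    using i M by simp
qed

section \<open>Averaging of fast oscillations\<close>

text \<open>One \<open>N\<close> bounds both the function and its derivative divided by \<epsilon>,
  so sums and products stay within the class. The derivative is continuous because it appears later
  in the second derivative of the remainder; \<open>0 \<le> N\<close> is stated since
  \<open>{0..T}\<close> may be empty.\<close>

definition slow :: "real \<Rightarrow> real \<Rightarrow> real \<Rightarrow> (real \<Rightarrow> complex) \<Rightarrow> bool" where
  "slow \<epsilon> T N C \<longleftrightarrow> 0 \<le> N \<and> (\<exists>C'. continuous_on {0..T} C' \<and> (\<forall>t\<in>{0..T}. (C has_vector_derivative C' t) (at t within {0..T}) \<and>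
     norm (C t) \<le> N \<and> norm (C' t) \<le> \<epsilon> * N))"

lemma slow_continuous_on: "slow \<epsilon> T N C \<Longrightarrow> continuous_on {0..T} C"
  unfolding slow_def by (metis continuous_on_vector_derivative)

lemma slow_const: "0 \<le> \<epsilon> \<Longrightarrow> slow \<epsilon> T (norm c) (\<lambda>_. c)"
  unfolding slow_def by (auto intro!: exI[of _ "\<lambda>_. 0"])

lemma slow_add:
  assumes "slow \<epsilon> T N f" "slow \<epsilon> T N' g"
  shows "slow \<epsilon> T (N + N') (\<lambda>t. f t + g t)"
proof -
  from assms obtain f' g' where fg: "0 \<le> N" "0 \<le> N'"
    "continuous_on {0..T} f'" "continuous_on {0..T} g'"
    "\<forall>t\<in>{0..T}. (f has_vector_derivative f' t) (at t within {0..T}) \<and> norm (f t) \<le> N \<and> norm (f' t) \<le> \<epsilon> * N"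
    "\<forall>t\<in>{0..T}. (g has_vector_derivative g' t) (at t within {0..T}) \<and> norm (g t) \<le> N' \<and> norm (g' t) \<le> \<epsilon> * N'"
    by (auto simp: slow_def)
  show ?thesis
    unfolding slow_def
  proof (intro conjI exI[of _ "\<lambda>t. f' t + g' t"] ballI)
    show "continuous_on {0..T} (\<lambda>t. f' t + g' t)"
      using fg by (intro continuous_intros)
    fix t assume t: "t \<in> {0..T}"
    show "((\<lambda>t. f t + g t) has_vector_derivative f' t + g' t) (at t within {0..T})"
      using fg t by (intro has_vector_derivative_add) auto
    show "norm (f t + g t) \<le> N + N'"
      using fg t by (intro norm_triangle_mono) auto
    have "norm (f' t + g' t) \<le> \<epsilon> * N + \<epsilon> * N'"
      using fg t by (intro norm_triangle_mono) auto
    then show "norm (f' t + g' t) \<le> \<epsilon> * (N + N')"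
      by (simp add: algebra_simps)
  qed (use fg in auto)
qed

text \<open>The factor 2 pays for the two terms of the product rule.\<close>

lemma slow_mult:
  assumes "slow \<epsilon> T N f" "slow \<epsilon> T N' g" "0 \<le> \<epsilon>"
  shows "slow \<epsilon> T (2 * N * N') (\<lambda>t. f t * g t)"
proof -
  from assms obtain f' g' where fg: "0 \<le> N" "0 \<le> N'"
    "continuous_on {0..T} f'" "continuous_on {0..T} g'"
    "\<forall>t\<in>{0..T}. (f has_vector_derivative f' t) (at t within {0..T}) \<and> norm (f t) \<le> N \<and> norm (f' t) \<le> \<epsilon> * N"
    "\<forall>t\<in>{0..T}. (g has_vector_derivative g' t) (at t within {0..T}) \<and> norm (g t) \<le> N' \<and> norm (g' t) \<le> \<epsilon> * N'"
    by (auto simp: slow_def)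
  show ?thesis
    unfolding slow_def
  proof (intro conjI exI[of _ "\<lambda>t. f t * g' t + f' t * g t"] ballI)
    show "continuous_on {0..T} (\<lambda>t. f t * g' t + f' t * g t)"
      using fg assms(1,2)[THEN slow_continuous_on] by (intro continuous_intros)
    fix t assume t: "t \<in> {0..T}"
    show "((\<lambda>t. f t * g t) has_vector_derivative f t * g' t + f' t * g t) (at t within {0..T})"
      using fg t by (intro has_vector_derivative_mult) auto
    have "norm (f t * g t) \<le> N * N'"
      unfolding norm_mult using fg t by (intro mult_mono) auto
    also have "\<dots> \<le> 2 * N * N'"
      using fg by simp
    finally show "norm (f t * g t) \<le> 2 * N * N'" .
    have "norm (f t * g' t + f' t * g t) \<le> N * (\<epsilon> * N') + (\<epsilon> * N) * N'"
      unfolding norm_mult using fg t assms(3)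
      by (intro norm_triangle_mono) (auto simp: norm_mult intro!: mult_mono)
    then show "norm (f t * g' t + f' t * g t) \<le> \<epsilon> * (2 * N * N')"
      by (simp add: algebra_simps)
  qed (use fg in auto)
qed

lemma slow_cnj:
  assumes "slow \<epsilon> T N f"
  shows "slow \<epsilon> T N (\<lambda>t. cnj (f t))"
proof -
  from assms obtain f' where "0 \<le> N" "continuous_on {0..T} f'"
    "\<forall>t\<in>{0..T}. (f has_vector_derivative f' t) (at t within {0..T}) \<and> norm (f t) \<le> N \<and> norm (f' t) \<le> \<epsilon> * N"
    by (auto simp: slow_def)
  then show ?thesis
    unfolding slow_def
    by (intro conjI exI[of _ "\<lambda>t. cnj (f' t)"])
       (auto intro: has_vector_derivative_cnj continuous_intros)
qed

lemma has_vector_derivative_cis: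
  "((\<lambda>t. cis (\<mu> * t)) has_vector_derivative \<i> * of_real \<mu> * cis (\<mu> * t)) (at t within S)"
  unfolding cis.ctr[abs_def] has_vector_derivative_complex_iff
  by (auto intro!: derivative_eq_intros simp: has_real_derivative_iff_has_vector_derivative[symmetric])

lemma slow_cis:
  assumes "0 \<le> \<epsilon>"
  shows "slow \<epsilon> T (1 + \<bar>\<sigma>\<bar>) (\<lambda>t. cis (\<epsilon> * \<sigma> * t))"
  unfolding slow_def
proof (intro conjI exI ballI)
  show "((\<lambda>t. cis (\<epsilon> * \<sigma> * t)) has_vector_derivative \<i> * of_real (\<epsilon> * \<sigma>) * cis (\<epsilon> * \<sigma> * t))
          (at t within {0..T})" for t
    by (rule has_vector_derivative_cis)
  show "continuous_on {0..T} (\<lambda>t. \<i> * of_real (\<epsilon> * \<sigma>) * cis (\<epsilon> * \<sigma> * t))"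
    by (intro continuous_intros)
  show "norm (\<i> * of_real (\<epsilon> * \<sigma>) * cis (\<epsilon> * \<sigma> * t)) \<le> \<epsilon> * (1 + \<bar>\<sigma>\<bar>)" for t
    using assms by (simp add: norm_mult abs_mult algebra_simps)
qed auto

text \<open>\<open>H\<close> is a primitive of \<open>R\<close> up to the error \<rho>. On an
  interval of length \<gamma> / \<epsilon> this error contributes at most
  \<open>\<gamma> * N\<close> to the integral, which is of the same order as the bound on
  \<open>H\<close>.\<close>

definition small_primitive :: "real \<Rightarrow> real \<Rightarrow> real \<Rightarrow> (real \<Rightarrow> complex) \<Rightarrow> bool" where
  "small_primitive \<epsilon> T N R \<longleftrightarrow> (\<exists>H \<rho>. \<forall>t\<in>{0..T}. norm (H t) \<le> N \<and> norm (\<rho> t) \<le> \<epsilon> * N \<and>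
     (H has_vector_derivative R t + \<rho> t) (at t within {0..T}))"

lemma small_primitive_zero: "small_primitive \<epsilon> T 0 (\<lambda>_. 0)"
  unfolding small_primitive_def by (intro exI[of _ "\<lambda>_. 0"]) auto

lemma small_primitive_add:
  assumes "small_primitive \<epsilon> T N f" "small_primitive \<epsilon> T N' g"
  shows "small_primitive \<epsilon> T (N + N') (\<lambda>t. f t + g t)"
proof -
  from assms obtain F p G q where
    F: "\<forall>t\<in>{0..T}. norm (F t) \<le> N \<and> norm (p t) \<le> \<epsilon> * N \<and>
          (F has_vector_derivative f t + p t) (at t within {0..T})" and
    G: "\<forall>t\<in>{0..T}. norm (G t) \<le> N' \<and> norm (q t) \<le> \<epsilon> * N' \<and>
          (G has_vector_derivative g t + q t) (at t within {0..T})"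
    by (auto simp: small_primitive_def)
  show ?thesis
    unfolding small_primitive_def
  proof (rule exI[of _ "\<lambda>t. F t + G t"], rule exI[of _ "\<lambda>t. p t + q t"], intro conjI ballI)
    fix t assume t: "t \<in> {0..T}"
    show "norm (F t + G t) \<le> N + N'"
      using F G t by (intro norm_triangle_mono) auto
    have "norm (p t + q t) \<le> \<epsilon> * N + \<epsilon> * N'"
      using F G t by (intro norm_triangle_mono) auto
    then show "norm (p t + q t) \<le> \<epsilon> * (N + N')"
      by (simp add: algebra_simps)
    have "((\<lambda>t. F t + G t) has_vector_derivative (f t + p t) + (g t + q t)) (at t within {0..T})"
      using F G t by (intro has_vector_derivative_add) auto
    then show "((\<lambda>t. F t + G t) has_vector_derivative f t + g t + (p t + q t)) (at t within {0..T})"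
      by (simp add: algebra_simps)
  qed
qed

text \<open>Integration by parts: the derivative of
  \<open>cis (\<mu> * t) * C t / (\<i> * \<mu>)\<close> is the given function plus a term with
  \<open>C'\<close>, which is O(\<epsilon>). The price is the divisor \<mu>; in the application only
  finitely many frequencies occur, so the constants stay bounded.\<close>

lemma small_primitive_osc:
  assumes "slow \<epsilon> T N C" "\<mu> \<noteq> 0"
  shows "small_primitive \<epsilon> T (N / \<bar>\<mu>\<bar>) (\<lambda>t. cis (\<mu> * t) * C t)"
proof -
  from assms obtain C' where C: "0 \<le> N"
    "continuous_on {0..T} C'"
    "\<forall>t\<in>{0..T}. (C has_vector_derivative C' t) (at t within {0..T}) \<and> norm (C t) \<le> N \<and> norm (C' t) \<le> \<epsilon> * N"
    by (auto simp: slow_def)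
  show ?thesis
    unfolding small_primitive_def
  proof (rule exI[of _ "\<lambda>t. cis (\<mu> * t) * C t * (1 / (\<i> * of_real \<mu>))"],
      rule exI[of _ "\<lambda>t. cis (\<mu> * t) * C' t * (1 / (\<i> * of_real \<mu>))"], intro conjI ballI)
    fix t assume t: "t \<in> {0..T}"
    show "norm (cis (\<mu> * t) * C t * (1 / (\<i> * of_real \<mu>))) \<le> N / \<bar>\<mu>\<bar>"
      using C t by (auto simp: norm_mult norm_divide divide_right_mono)
    have "norm (C' t) / \<bar>\<mu>\<bar> \<le> \<epsilon> * N / \<bar>\<mu>\<bar>"
      using C t by (intro divide_right_mono) auto
    then show "norm (cis (\<mu> * t) * C' t * (1 / (\<i> * of_real \<mu>))) \<le> \<epsilon> * (N / \<bar>\<mu>\<bar>)"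
      by (simp add: norm_mult norm_divide)
    have "((\<lambda>t. cis (\<mu> * t) * C t * (1 / (\<i> * of_real \<mu>))) has_vector_derivative
        (cis (\<mu> * t) * C' t + (\<i> * of_real \<mu> * cis (\<mu> * t)) * C t) * (1 / (\<i> * of_real \<mu>))) (at t within {0..T})"
      using C t by (intro has_vector_derivative_mult_left has_vector_derivative_mult
          has_vector_derivative_cis) auto
    also have "(cis (\<mu> * t) * C' t + (\<i> * of_real \<mu> * cis (\<mu> * t)) * C t) * (1 / (\<i> * of_real \<mu>)) =
      cis (\<mu> * t) * C t + cis (\<mu> * t) * C' t * (1 / (\<i> * of_real \<mu>))"
      using assms(2) by (simp add: field_simps)
    finally show "((\<lambda>t. cis (\<mu> * t) * C t * (1 / (\<i> * of_real \<mu>))) has_vector_derivative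
      cis (\<mu> * t) * C t + cis (\<mu> * t) * C' t * (1 / (\<i> * of_real \<mu>))) (at t within {0..T})" .
  qed
qed

lemma small_primitive_sum:
  assumes "finite J" "\<And>j. j \<in> J \<Longrightarrow> small_primitive \<epsilon> T (N j) (f j)"
  shows "small_primitive \<epsilon> T (\<Sum>j\<in>J. N j) (\<lambda>t. \<Sum>j\<in>J. f j t)"
  using assms
  by (induction J rule: finite_induct) (auto intro: small_primitive_zero small_primitive_add)

lemma small_primitive_mono:
  "small_primitive \<epsilon> T N f \<Longrightarrow> N \<le> N' \<Longrightarrow> 0 \<le> \<epsilon> \<Longrightarrow> small_primitive \<epsilon> T N' f"
  unfolding small_primitive_def by (meson mult_left_mono order_trans)

text \<open>Since \<open>L * \<gamma> \<le> 1 / 2\<close>, every common bound \<open>S\<close> of the \<open>e k\<close> improves to \<open>S / 2 + O(\<epsilon>)\<close>, which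
  is applied to the least one.\<close>

lemma averaging_bound:
  fixes e :: "'i \<Rightarrow> real \<Rightarrow> complex"
  assumes I: "finite I" and \<epsilon>: "0 < \<epsilon>" and N: "0 \<le> N" and L: "0 \<le> L"
    and T: "0 \<le> T" "\<epsilon> * T \<le> \<gamma>" and L\<gamma>: "L * \<gamma> \<le> 1 / 2"
    and der: "\<And>k t. k \<in> I \<Longrightarrow> t \<in> {0..T} \<Longrightarrow>
                (e k has_vector_derivative of_real \<epsilon> * (Q k t + R k t)) (at t within {0..T})"
    and Q: "\<And>k t S. k \<in> I \<Longrightarrow> t \<in> {0..T} \<Longrightarrow> (\<And>i. i \<in> I \<Longrightarrow> norm (e i t) \<le> S) \<Longrightarrow>
              norm (Q k t) \<le> L * S"
    and R: "\<And>k. k \<in> I \<Longrightarrow> small_primitive \<epsilon> T N (R k)"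
    and init: "\<And>k. k \<in> I \<Longrightarrow> norm (e k 0) \<le> \<epsilon> * N"
    and kt: "k \<in> I" "t \<in> {0..T}"
  shows "norm (e k t) \<le> \<epsilon> * (2 * (3 + \<gamma>) * N)"
proof -
  have e_cont: "continuous_on {0..T} (e i)" if "i \<in> I" for i
    using der[OF that] by (rule continuous_on_vector_derivative)
  have improve: "norm (e i u) \<le> S / 2 + \<epsilon> * ((3 + \<gamma>) * N)"
    if S: "\<And>j s. j \<in> I \<Longrightarrow> s \<in> {0..T} \<Longrightarrow> norm (e j s) \<le> S" and i: "i \<in> I" and u: "u \<in> {0..T}" for S i u
  proof -
    have S0: "0 \<le> S"
      using S[OF i u] norm_ge_zero order_trans by blast
    from R[OF i] obtain H \<rho> where H: "\<And>t. t \<in> {0..T} \<Longrightarrow> norm (H t) \<le> N"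
      "\<And>t. t \<in> {0..T} \<Longrightarrow> norm (\<rho> t) \<le> \<epsilon> * N"
      "\<And>t. t \<in> {0..T} \<Longrightarrow> (H has_vector_derivative R i t + \<rho> t) (at t within {0..T})"
      unfolding small_primitive_def by blast
    \<comment> \<open>Subtracting \<epsilon> times the primitive cancels \<open>R\<close> and leaves
      \<open>Q\<close> and the O(\<epsilon>) error in the derivative.\<close>
    define h where "h t = e i t - of_real \<epsilon> * H t" for t
    have h_der: "(h has_vector_derivative of_real \<epsilon> * (Q i t - \<rho> t)) (at t within {0..T})"
      if "t \<in> {0..T}" for t
    proof -
      have "(h has_vector_derivative of_real \<epsilon> * (Q i t + R i t) - of_real \<epsilon> * (R i t + \<rho> t)) (at t within {0..T})"
        unfolding h_def
        by (intro has_vector_derivative_diff has_vector_derivative_mult_right der i that H)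
      then show ?thesis
        by (simp add: algebra_simps)
    qed
    have h_bnd: "norm (of_real \<epsilon> * (Q i t - \<rho> t)) \<le> \<epsilon> * (L * S + \<epsilon> * N)" if "t \<in> {0..T}" for t
    proof -
      have "norm (Q i t - \<rho> t) \<le> L * S + \<epsilon> * N"
        by (rule order_trans[OF norm_triangle_ineq4]) (intro add_mono Q i that S H)
      then show ?thesis
        using \<epsilon> by (simp add: norm_mult)
    qed
    have "norm (h u - h 0) \<le> \<epsilon> * (L * S + \<epsilon> * N) * norm (u - 0)"
    proof (rule differentiable_bound[where S = "{0..T}"])
      show "(h has_derivative (\<lambda>x. x *\<^sub>R (of_real \<epsilon> * (Q i t - \<rho> t)))) (at t within {0..T})"
        if "t \<in> {0..T}" for t
        using h_der[OF that] by (simp add: has_vector_derivative_def)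
      show "onorm (\<lambda>x. x *\<^sub>R (of_real \<epsilon> * (Q i t - \<rho> t))) \<le> \<epsilon> * (L * S + \<epsilon> * N)" if "t \<in> {0..T}" for t
        using h_bnd[OF that] by (intro onorm_le) (simp add: mult.commute mult_left_mono)
    qed (use u T in auto)
    also have "\<dots> \<le> \<epsilon> * (L * S + \<epsilon> * N) * T"
      using u \<epsilon> L S0 N by (intro mult_left_mono) auto
    also have "\<dots> = (\<epsilon> * T) * (L * S + \<epsilon> * N)"
      by simp
    also have "\<dots> \<le> \<gamma> * (L * S + \<epsilon> * N)"
      using T \<epsilon> L S0 N by (intro mult_right_mono) auto
    also have "\<dots> = (L * \<gamma>) * S + \<gamma> * \<epsilon> * N"
      by (simp add: algebra_simps)
    also have "\<dots> \<le> (1 / 2) * S + \<gamma> * \<epsilon> * N"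
      using L\<gamma> S0 by (intro add_right_mono mult_right_mono) auto
    finally have 1: "norm (h u - h 0) \<le> (1 / 2) * S + \<gamma> * \<epsilon> * N" .
    have 2: "norm (of_real \<epsilon> * H s) \<le> \<epsilon> * N" if "s \<in> {0..T}" for s
      using H(1)[OF that] \<epsilon> by (simp add: norm_mult)
    \<comment> \<open>Origin of \<open>3 + \<gamma>\<close>: one \<open>N\<close> from the initial
      value, one each from \<open>H u\<close> and \<open>H 0\<close>, and
      \<open>\<gamma> * N\<close> from integrating \<rho>.\<close>
    have "e i u = (h u - h 0) + of_real \<epsilon> * H u + (e i 0 - of_real \<epsilon> * H 0)"
      by (simp add: h_def)
    also have "norm \<dots> \<le> ((1 / 2) * S + \<gamma> * \<epsilon> * N) + \<epsilon> * N + (\<epsilon> * N + \<epsilon> * N)"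
      using init[OF i] 2[of 0] u
      by (intro norm_triangle_mono order_trans[OF norm_triangle_ineq4] add_mono 1 2) auto
    finally show ?thesis
      by (simp add: algebra_simps)
  qed
  define X where "X = (\<Union>i\<in>I. (\<lambda>s. norm (e i s)) ` {0..T})"
  have "bdd_above X"
    unfolding X_def bdd_above_UN[OF I]
    by (intro ballI bounded_imp_bdd_above compact_imp_bounded compact_continuous_image
        continuous_intros e_cont) auto
  then have le_Sup: "norm (e i s) \<le> Sup X" if "i \<in> I" "s \<in> {0..T}" for i s
    using that unfolding X_def by (intro cSup_upper) blast+
  \<comment> \<open>The supremum is finite because \<open>X\<close> is bounded, so half of it can be
    absorbed on the left; this doubles the constant.\<close>
  have "Sup X \<le> Sup X / 2 + \<epsilon> * ((3 + \<gamma>) * N)"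
    using kt improve[OF le_Sup] by (intro cSup_least) (auto simp: X_def)
  with le_Sup[OF kt] show ?thesis
    by (simp add: algebra_simps)
qed

text \<open>\<open>F\<close> builds a function of time from \<epsilon> and \<open>B\<close>. The
  bound \<open>N\<close> is chosen before \<epsilon>, the interval and \<open>B\<close>; the closure
  rules below then yield a uniform constant for any polynomial expression in \<open>B\<close>, its
  conjugate and slow phases, without that constant ever being computed.\<close>

definition slow_op :: "real \<Rightarrow> (real \<Rightarrow> (real \<Rightarrow> complex) \<Rightarrow> real \<Rightarrow> complex) \<Rightarrow> bool" where
  "slow_op M F \<longleftrightarrow> (\<exists>N. \<forall>\<epsilon> T B. 0 \<le> \<epsilon> \<longrightarrow> slow \<epsilon> T M B \<longrightarrow> slow \<epsilon> T N (F \<epsilon> B))"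

lemma slow_op_id: "slow_op M (\<lambda>\<epsilon> B t. B t)"
  unfolding slow_op_def by blast

lemma slow_op_const: "slow_op M (\<lambda>\<epsilon> B t. c)"
  unfolding slow_op_def using slow_const by blast

lemma slow_op_cis: "slow_op M (\<lambda>\<epsilon> B t. cis (\<epsilon> * \<sigma> * t))"
  unfolding slow_op_def using slow_cis by blast

lemma slow_op_add: "slow_op M F \<Longrightarrow> slow_op M G \<Longrightarrow> slow_op M (\<lambda>\<epsilon> B t. F \<epsilon> B t + G \<epsilon> B t)"
  unfolding slow_op_def using slow_add by meson

lemma slow_op_mult: "slow_op M F \<Longrightarrow> slow_op M G \<Longrightarrow> slow_op M (\<lambda>\<epsilon> B t. F \<epsilon> B t * G \<epsilon> B t)"
  unfolding slow_op_def using slow_mult by meson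

lemma slow_op_cnj: "slow_op M F \<Longrightarrow> slow_op M (\<lambda>\<epsilon> B t. cnj (F \<epsilon> B t))"
  unfolding slow_op_def using slow_cnj by meson

lemma slow_op_if:
  "slow_op M F \<Longrightarrow> slow_op M G \<Longrightarrow> slow_op M (\<lambda>\<epsilon> B t. if b then F \<epsilon> B t else G \<epsilon> B t)"
  by (cases b) simp_all

lemma slow_mono: "slow \<epsilon> T N C \<Longrightarrow> N \<le> N' \<Longrightarrow> 0 \<le> \<epsilon> \<Longrightarrow> slow \<epsilon> T N' C"
  unfolding slow_def by (meson mult_left_mono order_trans)

lemma continuous_on_if_const:
  "continuous_on A F \<Longrightarrow> continuous_on A G \<Longrightarrow> continuous_on A (\<lambda>t. if b then F t else G t)"
  by (cases b) simp_all

section \<open>The modal system in rotating amplitudes\<close>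

locale modal_system =
  fixes n :: nat and \<omega> lam f D :: "nat \<Rightarrow> real" and c d \<sigma> :: real
  assumes n_pos: "1 \<le> n"
    and \<omega>_pos: "\<And>k. k \<in> {1..n} \<Longrightarrow> 0 < \<omega> k"
    and nonres: "\<And>k. k \<in> {1..n} \<Longrightarrow> k \<noteq> 1 \<Longrightarrow> Z_independent (\<omega> k) (\<omega> 1)"
begin

text \<open>An amplitude \<open>z\<close> of mode \<open>k\<close> stands for the scaled displacement \<open>x\<^sub>k = y\<^sub>k / \<epsilon>\<close> and velocity with
  \<open>cis (\<omega> k * t) * z = x\<^sub>k' + \<i> \<omega>\<^sub>k x\<^sub>k\<close>.\<close>

definition displ :: "nat \<Rightarrow> real \<Rightarrow> complex \<Rightarrow> real" where
  "displ k t z = Im (cis (\<omega> k * t) * z) / \<omega> k"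

definition veloc :: "nat \<Rightarrow> real \<Rightarrow> complex \<Rightarrow> real" where
  "veloc k t z = Re (cis (\<omega> k * t) * z)"

text \<open>This is \<open>(u_p - u_(p-1)) / \<epsilon>\<close>, the scaled argument of the
  nonlinearity.\<close>

definition stretch :: "real \<Rightarrow> (nat \<Rightarrow> complex) \<Rightarrow> real" where
  "stretch t w = (\<Sum>i=1..n. displ i t (w i) * D i)"

text \<open>The modal equation reads
  \<open>y'' + \<omega>\<^sup>2 y = \<epsilon>\<^sup>2 * force\<close>. The powers of \<epsilon> in
  the nonlinear terms cancel because \<open>c (\<epsilon> S)\<^sup>2\<close> and
  \<open>(d / \<epsilon>) (\<epsilon> S)\<^sup>3\<close> are both of order
  \<open>\<epsilon>\<^sup>2\<close>.\<close>

definition force :: "real \<Rightarrow> nat \<Rightarrow> real \<Rightarrow> (nat \<Rightarrow> complex) \<Rightarrow> real" where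
  "force \<epsilon> k t w = f k * cos ((\<omega> 1 + \<epsilon> * \<sigma>) * t) - lam k * veloc k t (w k)
     - D k * (c * (stretch t w)\<^sup>2 + d * (stretch t w) ^ 3)"

definition field :: "real \<Rightarrow> nat \<Rightarrow> real \<Rightarrow> (nat \<Rightarrow> complex) \<Rightarrow> complex" where
  "field \<epsilon> k t w = cis (- \<omega> k * t) * of_real (force \<epsilon> k t w)"

text \<open>Bound of the linear functional \<open>stretch\<close> in the maximum norm of the
  amplitudes.\<close>

definition \<kappa> :: real where "\<kappa> = (\<Sum>i=1..n. \<bar>D i\<bar> / \<omega> i)"

section \<open>Bounds, Lipschitz constants and continuity of the force\<close>

lemma one_mem: "1 \<in> {1..n}"
  using n_pos by simp

lemma \<kappa>_nonneg: "0 \<le> \<kappa>"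
  unfolding \<kappa>_def using \<omega>_pos by (intro sum_nonneg divide_nonneg_pos) auto

lemma displ_diff: "displ k t z - displ k t z' = displ k t (z - z')"
  by (simp add: displ_def algebra_simps diff_divide_distrib)

lemma veloc_diff: "veloc k t z - veloc k t z' = veloc k t (z - z')"
  by (simp add: veloc_def algebra_simps)

lemma abs_displ_le: "k \<in> {1..n} \<Longrightarrow> \<bar>displ k t z\<bar> \<le> norm z / \<omega> k"
  unfolding displ_def abs_divide
  using \<omega>_pos[of k] abs_Im_le_cmod[of "cis (\<omega> k * t) * z"]
  by (simp add: norm_mult divide_right_mono del: times_complex.sel)

lemma abs_veloc_le: "\<bar>veloc k t z\<bar> \<le> norm z"
  unfolding veloc_def
  using abs_Re_le_cmod[of "cis (\<omega> k * t) * z"] by (simp add: norm_mult del: times_complex.sel)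

lemma stretch_diff: "stretch t w - stretch t v = stretch t (\<lambda>i. w i - v i)"
  unfolding stretch_def sum_subtractf[symmetric] left_diff_distrib[symmetric] displ_diff ..

lemma abs_stretch_le:
  fixes w :: "nat \<Rightarrow> complex"
  assumes "\<And>i. i \<in> {1..n} \<Longrightarrow> norm (w i) \<le> \<rho>"
  shows "\<bar>stretch t w\<bar> \<le> \<kappa> * \<rho>"
proof -
  have "\<bar>stretch t w\<bar> \<le> (\<Sum>i=1..n. \<bar>D i\<bar> / \<omega> i * \<rho>)"
    unfolding stretch_def
  proof (rule sum_norm_le[where 'a = real, unfolded real_norm_def])
    fix i assume i: "i \<in> {1..n}"
    have "\<bar>displ i t (w i)\<bar> \<le> \<rho> / \<omega> i"
      using abs_displ_le[OF i, of t "w i"] assms[OF i] \<omega>_pos[OF i]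
      by (meson divide_right_mono less_imp_le order_trans)
    then have "\<bar>displ i t (w i)\<bar> * \<bar>D i\<bar> \<le> \<rho> / \<omega> i * \<bar>D i\<bar>"
      by (intro mult_right_mono) auto
    then show "\<bar>displ i t (w i) * D i\<bar> \<le> \<bar>D i\<bar> / \<omega> i * \<rho>"
      by (simp add: abs_mult mult.commute)
  qed
  then show ?thesis
    by (simp add: \<kappa>_def sum_distrib_right)
qed

lemma norm_field: "norm (field \<epsilon> k t w) = \<bar>force \<epsilon> k t w\<bar>"
  by (simp add: field_def norm_mult)

lemma force_bounded:
  assumes "0 \<le> \<rho>"
  obtains M where "0 \<le> M"
    and "\<And>\<epsilon> k t (w :: nat \<Rightarrow> complex). k \<in> {1..n} \<Longrightarrow> (\<And>i. i \<in> {1..n} \<Longrightarrow> norm (w i) \<le> \<rho>) \<Longrightarrow> \<bar>force \<epsilon> k t w\<bar> \<le> M"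
proof
  define m where "m k = \<bar>f k\<bar> + \<bar>lam k\<bar> * \<rho> + \<bar>D k\<bar> * (\<bar>c\<bar> * (\<kappa> * \<rho>)\<^sup>2 + \<bar>d\<bar> * (\<kappa> * \<rho>) ^ 3)" for k
  have m_nonneg: "0 \<le> m k" for k
    using assms \<kappa>_nonneg by (simp add: m_def)
  show "0 \<le> (\<Sum>k=1..n. m k)"
    using m_nonneg by (intro sum_nonneg)
  fix \<epsilon> t :: real and k and w :: "nat \<Rightarrow> complex" assume k: "k \<in> {1..n}" and w: "\<And>i. i \<in> {1..n} \<Longrightarrow> norm (w i) \<le> \<rho>"
  let ?S = "stretch t w"
  have S: "\<bar>?S\<bar> \<le> \<kappa> * \<rho>"
    by (rule abs_stretch_le[OF w])
  have "\<bar>f k * cos ((\<omega> 1 + \<epsilon> * \<sigma>) * t)\<bar> \<le> \<bar>f k\<bar>"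
    by (simp add: abs_mult mult_left_le)
  moreover have "\<bar>lam k * veloc k t (w k)\<bar> \<le> \<bar>lam k\<bar> * \<rho>"
    unfolding abs_mult using abs_veloc_le w[OF k] by (intro mult_left_mono) (auto intro: order_trans)
  moreover have "\<bar>D k * (c * ?S\<^sup>2 + d * ?S ^ 3)\<bar> \<le> \<bar>D k\<bar> * (\<bar>c\<bar> * (\<kappa> * \<rho>)\<^sup>2 + \<bar>d\<bar> * (\<kappa> * \<rho>) ^ 3)"
    unfolding abs_mult
  proof (intro mult_left_mono order_trans[OF abs_triangle_ineq] add_mono)
    show "\<bar>c * ?S\<^sup>2\<bar> \<le> \<bar>c\<bar> * (\<kappa> * \<rho>)\<^sup>2"
      unfolding abs_mult power_abs using S by (intro mult_left_mono power_mono) auto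
    show "\<bar>d * ?S ^ 3\<bar> \<le> \<bar>d\<bar> * (\<kappa> * \<rho>) ^ 3"
      unfolding abs_mult power_abs using S by (intro mult_left_mono power_mono) auto
  qed auto
  ultimately have "\<bar>force \<epsilon> k t w\<bar> \<le> m k"
    unfolding force_def m_def by linarith
  also have "m k \<le> (\<Sum>k=1..n. m k)"
    using k m_nonneg by (intro member_le_sum) auto
  finally show "\<bar>force \<epsilon> k t w\<bar> \<le> (\<Sum>k=1..n. m k)" .
qed

text \<open>A common bound \<open>e\<close> for all components replaces a norm on amplitude vectors,
  in the form that \<open>picard_on_ball\<close> and \<open>averaging_bound\<close> ask for.
  Rotation by \<open>cis\<close> preserves moduli, so the real force decides, where squares and
  cubes are factored through the difference of the stretches.\<close>

lemma field_lipschitz: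
  assumes "0 \<le> \<rho>"
  obtains L where "0 \<le> L"
    and "\<And>\<epsilon> k t (w :: nat \<Rightarrow> complex) v e. k \<in> {1..n} \<Longrightarrow> (\<And>i. i \<in> {1..n} \<Longrightarrow> norm (w i) \<le> \<rho>) \<Longrightarrow>
           (\<And>i. i \<in> {1..n} \<Longrightarrow> norm (v i) \<le> \<rho>) \<Longrightarrow> (\<And>i. i \<in> {1..n} \<Longrightarrow> norm (w i - v i) \<le> e) \<Longrightarrow>
           norm (field \<epsilon> k t w - field \<epsilon> k t v) \<le> L * e"
proof
  define r where "r = \<kappa> * \<rho>"
  define m where "m k = \<bar>lam k\<bar> + \<bar>D k\<bar> * (\<bar>c\<bar> * (2 * r * \<kappa>) + \<bar>d\<bar> * (3 * r\<^sup>2 * \<kappa>))" for k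
  have r: "0 \<le> r"
    using assms \<kappa>_nonneg by (simp add: r_def)
  have m_nonneg: "0 \<le> m k" for k
    using r \<kappa>_nonneg by (simp add: m_def)
  show "0 \<le> (\<Sum>k=1..n. m k)"
    using m_nonneg by (intro sum_nonneg)
  fix \<epsilon> t e :: real and k and w v :: "nat \<Rightarrow> complex"
  assume k: "k \<in> {1..n}" and w: "\<And>i. i \<in> {1..n} \<Longrightarrow> norm (w i) \<le> \<rho>"
    and v: "\<And>i. i \<in> {1..n} \<Longrightarrow> norm (v i) \<le> \<rho>"
    and e: "\<And>i. i \<in> {1..n} \<Longrightarrow> norm (w i - v i) \<le> e"
  let ?S = "stretch t w" and ?U = "stretch t v"
  have e0: "0 \<le> e"
    using e[OF k] norm_ge_zero order_trans by blast
  have S: "\<bar>?S\<bar> \<le> r" and U: "\<bar>?U\<bar> \<le> r"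
    unfolding r_def by (rule abs_stretch_le[OF w] abs_stretch_le[OF v]; assumption)+
  have SU: "\<bar>?S - ?U\<bar> \<le> \<kappa> * e"
    unfolding stretch_diff by (rule abs_stretch_le[OF e])
  have sq: "\<bar>?S\<^sup>2 - ?U\<^sup>2\<bar> \<le> (2 * r * \<kappa>) * e"
  proof -
    have "\<bar>?S\<^sup>2 - ?U\<^sup>2\<bar> = \<bar>?S + ?U\<bar> * \<bar>?S - ?U\<bar>"
      by (simp add: power2_eq_square algebra_simps flip: abs_mult)
    also have "\<dots> \<le> (2 * r) * (\<kappa> * e)"
      using S U SU r by (intro mult_mono) auto
    finally show ?thesis by (simp add: mult_ac)
  qed
  have cube: "\<bar>?S ^ 3 - ?U ^ 3\<bar> \<le> (3 * r\<^sup>2 * \<kappa>) * e"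
  proof -
    have "\<bar>x * y\<bar> \<le> r * r" if "\<bar>x\<bar> \<le> r" "\<bar>y\<bar> \<le> r" for x y :: real
      unfolding abs_mult using that r by (intro mult_mono) auto
    from this[OF S S] this[OF S U] this[OF U U]
    have "\<bar>?S * ?S + ?S * ?U + ?U * ?U\<bar> \<le> r * r + r * r + r * r"
      by linarith
    moreover have "\<bar>?S ^ 3 - ?U ^ 3\<bar> = \<bar>?S * ?S + ?S * ?U + ?U * ?U\<bar> * \<bar>?S - ?U\<bar>"
      by (simp add: power3_eq_cube algebra_simps flip: abs_mult)
    ultimately have "\<bar>?S ^ 3 - ?U ^ 3\<bar> \<le> (r * r + r * r + r * r) * (\<kappa> * e)"
      using SU r by (auto intro!: mult_mono)
    then show ?thesis by (simp add: power2_eq_square algebra_simps)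
  qed
  have "\<bar>lam k * (veloc k t (w k) - veloc k t (v k))\<bar> \<le> \<bar>lam k\<bar> * e"
    unfolding abs_mult veloc_diff using abs_veloc_le e[OF k] by (intro mult_left_mono) (auto intro: order_trans)
  moreover have "\<bar>D k * (c * (?S\<^sup>2 - ?U\<^sup>2) + d * (?S ^ 3 - ?U ^ 3))\<bar> \<le>
      \<bar>D k\<bar> * (\<bar>c\<bar> * ((2 * r * \<kappa>) * e) + \<bar>d\<bar> * ((3 * r\<^sup>2 * \<kappa>) * e))"
    unfolding abs_mult
  proof (intro mult_left_mono order_trans[OF abs_triangle_ineq] add_mono)
    show "\<bar>c * (?S\<^sup>2 - ?U\<^sup>2)\<bar> \<le> \<bar>c\<bar> * ((2 * r * \<kappa>) * e)"
      unfolding abs_mult using sq by (intro mult_left_mono) auto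
    show "\<bar>d * (?S ^ 3 - ?U ^ 3)\<bar> \<le> \<bar>d\<bar> * ((3 * r\<^sup>2 * \<kappa>) * e)"
      unfolding abs_mult using cube by (intro mult_left_mono) auto
  qed auto
  moreover have "force \<epsilon> k t w - force \<epsilon> k t v = - (lam k * (veloc k t (w k) - veloc k t (v k)))
      - D k * (c * (?S\<^sup>2 - ?U\<^sup>2) + d * (?S ^ 3 - ?U ^ 3))"
    by (simp add: force_def algebra_simps)
  ultimately have "\<bar>force \<epsilon> k t w - force \<epsilon> k t v\<bar> \<le>
      \<bar>lam k\<bar> * e + \<bar>D k\<bar> * (\<bar>c\<bar> * ((2 * r * \<kappa>) * e) + \<bar>d\<bar> * ((3 * r\<^sup>2 * \<kappa>) * e))"
    by linarith
  also have "\<dots> = m k * e"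
    by (simp add: m_def algebra_simps)
  also have "\<dots> \<le> (\<Sum>k=1..n. m k) * e"
    using k m_nonneg e0 by (intro mult_right_mono member_le_sum) auto
  finally have "\<bar>force \<epsilon> k t w - force \<epsilon> k t v\<bar> \<le> (\<Sum>k=1..n. m k) * e" .
  moreover have "norm (field \<epsilon> k t w - field \<epsilon> k t v) = \<bar>force \<epsilon> k t w - force \<epsilon> k t v\<bar>"
    by (simp add: field_def norm_mult flip: right_diff_distrib of_real_diff)
  ultimately show "norm (field \<epsilon> k t w - field \<epsilon> k t v) \<le> (\<Sum>k=1..n. m k) * e"
    by simp
qed

lemma continuous_on_force:
  assumes "\<And>i. i \<in> {1..n} \<Longrightarrow> continuous_on A (W i)" "k \<in> {1..n}"
  shows "continuous_on A (\<lambda>t. force \<epsilon> k t (\<lambda>i. W i t))"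
proof -
  have "\<omega> i \<noteq> 0" if "i \<in> {1..n}" for i
    using \<omega>_pos[OF that] by simp
  then have "continuous_on A (\<lambda>t. stretch t (\<lambda>i. W i t))"
    unfolding stretch_def displ_def by (intro continuous_intros assms) auto
  then show ?thesis
    unfolding force_def veloc_def by (intro continuous_intros assms)
qed

lemma continuous_on_field:
  assumes "\<And>i. i \<in> {1..n} \<Longrightarrow> continuous_on A (W i)" "k \<in> {1..n}"
  shows "continuous_on A (\<lambda>t. field \<epsilon> k t (\<lambda>i. W i t))"
  unfolding field_def by (intro continuous_intros continuous_on_force assms)

text \<open>Coefficient of \<open>cis (j * \<omega> 1 * t)\<close> in the force on mode \<open>k\<close> when only mode 1 is excited, with
  amplitude \<open>z\<close>, for \<open>-3 \<le> j \<le> 3\<close>. The forcing contributes to \<open>j = 1\<close> and \<open>j = -1\<close> because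
  \<open>\<Omega> = \<omega>\<^sub>1 + \<epsilon> \<sigma>\<close> differs from \<open>\<omega>\<^sub>1\<close> by a slow frequency.\<close>

definition harm :: "real \<Rightarrow> nat \<Rightarrow> int \<Rightarrow> real \<Rightarrow> complex \<Rightarrow> complex" where
  "harm \<epsilon> k j t z =
    (let \<alpha> = of_real (c * D k * (D 1)\<^sup>2 / (4 * (\<omega> 1)\<^sup>2)) :: complex;
         \<beta> = of_real (d * D k * (D 1) ^ 3 / (8 * (\<omega> 1) ^ 3)) :: complex;
         \<phi> = of_real (f k / 2) :: complex;
         l = of_real (if k = 1 then lam 1 / 2 else 0) :: complex
     in if j = 0 then - 2 * \<alpha> * (z * cnj z)
        else if j = 1 then \<phi> * cis (\<epsilon> * \<sigma> * t) + (- l) * z + (3 * \<i> * \<beta>) * (z * (z * cnj z))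
        else if j = -1 then
          \<phi> * cnj (cis (\<epsilon> * \<sigma> * t)) + (- l) * cnj z + (- 3 * \<i> * \<beta>) * (cnj z * (z * cnj z))
        else if j = 2 then \<alpha> * (z * z)
        else if j = -2 then \<alpha> * (cnj z * cnj z)
        else if j = 3 then (- \<i> * \<beta>) * (z * (z * z))
        else (\<i> * \<beta>) * (cnj z * (cnj z * cnj z)))"

lemma slow_op_harm: "slow_op M (\<lambda>\<epsilon> B t. harm \<epsilon> k j t (B t))"
  unfolding harm_def Let_def
  by (intro slow_op_if slow_op_add slow_op_mult slow_op_cnj slow_op_const slow_op_cis slow_op_id)

text \<open>Euler's formula: the displacement is
  \<open>(p z - cnj (p z)) / (2 \<i> \<omega>\<^sub>1)\<close> with
  \<open>p = cis (\<omega> 1 * t)\<close>. Its square has the harmonics 0, 2, -2 and its cube 1, -1,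
  3, -3, the mixed powers collapsing by \<open>p * cnj p = 1\<close>. The rotation \<open>r\<close>
  of mode \<open>k\<close> shifts all frequencies by \<open>- \<omega> k\<close>.\<close>

lemma field_harmonics:
  assumes k: "k \<in> {1..n}"
  shows "field \<epsilon> k t (\<lambda>i. if i = 1 then z else 0) =
    (\<Sum>j\<in>{-3..3}. cis ((of_int j * \<omega> 1 - \<omega> k) * t) * harm \<epsilon> k j t z)"
proof -
  define p q r where "p = cis (\<omega> 1 * t)" and "q = cis (\<epsilon> * \<sigma> * t)" and "r = cis (- \<omega> k * t)"
  have pp: "p * cnj p = 1"
    by (simp add: p_def cis_cnj cis_mult)
  define x where "x = displ 1 t z"
  have \<omega>1: "\<omega> 1 \<noteq> 0" using \<omega>_pos[OF one_mem] by simp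
  have st: "stretch t (\<lambda>i. if i = 1 then z else 0) = x * D 1"
  proof -
    have "stretch t (\<lambda>i. if i = 1 then z else 0) = (\<Sum>i=1..n. if i = 1 then x * D 1 else 0)"
      unfolding stretch_def by (intro sum.cong) (auto simp: x_def displ_def)
    then show ?thesis using one_mem by (simp add: sum.delta)
  qed
  have v: "veloc k t (if k = 1 then z else 0) = (if k = 1 then Re (p * z) else 0)"
    by (auto simp: veloc_def p_def)
  have cosq: "complex_of_real (cos ((\<omega> 1 + \<epsilon> * \<sigma>) * t)) = (p * q + cnj p * cnj q) / 2"
  proof -
    have "p * q = cis ((\<omega> 1 + \<epsilon> * \<sigma>) * t)"
      by (simp add: p_def q_def cis_mult algebra_simps)
    then show ?thesis
      using complex_add_cnj[of "p * q"] by (simp flip: complex_cnj_mult)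
  qed
  have xe: "complex_of_real x = (p * z - cnj p * cnj z) / (2 * \<i> * of_real (\<omega> 1))"
    using complex_diff_cnj[of "p * z"] \<omega>1 by (simp add: x_def displ_def p_def field_simps)
  have x2: "complex_of_real (x\<^sup>2) = (2 * z * cnj z - p\<^sup>2 * z\<^sup>2 - (cnj p)\<^sup>2 * (cnj z)\<^sup>2) / (4 * (of_real (\<omega> 1))\<^sup>2)"
  proof -
    have "(p * z - cnj p * cnj z)\<^sup>2 = p\<^sup>2 * z\<^sup>2 + (cnj p)\<^sup>2 * (cnj z)\<^sup>2 - 2 * (p * cnj p) * z * cnj z"
      by (simp add: power2_eq_square algebra_simps)
    then show ?thesis
      unfolding of_real_power xe pp using \<omega>1 by (simp add: power_divide power_mult_distrib field_simps)
  qed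
  have x3: "complex_of_real (x ^ 3) = \<i> * (p ^ 3 * z ^ 3 - 3 * p * z\<^sup>2 * cnj z + 3 * cnj p * z * (cnj z)\<^sup>2
      - (cnj p) ^ 3 * (cnj z) ^ 3) / (8 * of_real (\<omega> 1) ^ 3)"
  proof -
    have "(p * z - cnj p * cnj z) ^ 3 = p ^ 3 * z ^ 3 - 3 * p * (p * cnj p) * z\<^sup>2 * cnj z
        + 3 * cnj p * (p * cnj p) * z * (cnj z)\<^sup>2 - (cnj p) ^ 3 * (cnj z) ^ 3"
      by (simp add: power2_eq_square power3_eq_cube algebra_simps)
    moreover have "(2 * \<i> * of_real (\<omega> 1)) ^ 3 = - \<i> * (8 * of_real (\<omega> 1) ^ 3)"
      by (simp add: power_mult_distrib power3_eq_cube)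
    moreover have "a / (- \<i> * b) = \<i> * a / b" for a b :: complex
      by (cases "b = 0") (simp_all add: field_simps)
    ultimately show ?thesis
      unfolding of_real_power xe power_divide pp by simp
  qed
  define \<alpha> where "\<alpha> = complex_of_real (c * D k * (D 1)\<^sup>2 / (4 * (\<omega> 1)\<^sup>2))"
  define \<beta> where "\<beta> = complex_of_real (d * D k * (D 1) ^ 3 / (8 * (\<omega> 1) ^ 3))"
  define \<phi> where "\<phi> = complex_of_real (f k / 2)"
  define l where "l = complex_of_real (if k = 1 then lam 1 / 2 else 0)"
  have "complex_of_real (force \<epsilon> k t (\<lambda>i. if i = 1 then z else 0)) =
      of_real (f k) * of_real (cos ((\<omega> 1 + \<epsilon> * \<sigma>) * t)) - l * (2 * of_real (Re (p * z)))
      - of_real (c * D k * (D 1)\<^sup>2) * of_real (x\<^sup>2) - of_real (d * D k * (D 1) ^ 3) * of_real (x ^ 3)"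
    unfolding force_def st v l_def by (simp add: algebra_simps power_mult_distrib)
  also have "\<dots> = \<phi> * (p * q + cnj p * cnj q) - l * (p * z + cnj p * cnj z)
      - \<alpha> * (2 * z * cnj z - p\<^sup>2 * z\<^sup>2 - (cnj p)\<^sup>2 * (cnj z)\<^sup>2)
      - \<beta> * (\<i> * (p ^ 3 * z ^ 3 - 3 * p * z\<^sup>2 * cnj z + 3 * cnj p * z * (cnj z)\<^sup>2
      - (cnj p) ^ 3 * (cnj z) ^ 3))"
    unfolding cosq x2 x3 using complex_add_cnj[of "p * z"] by (simp add: \<alpha>_def \<beta>_def \<phi>_def)
  finally have fr: "field \<epsilon> k t (\<lambda>i. if i = 1 then z else 0) = r * \<dots>"
    unfolding field_def r_def by simp
  have sum7: "(\<Sum>j\<in>{-3..3::int}. g j) = g (-3) + g (-2) + g (-1) + g 0 + g 1 + g 2 + g 3" for g :: "int \<Rightarrow> complex"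
  proof -
    have "{-3..3::int} = {-3, -2, -1, 0, 1, 2, 3}" by auto
    then show ?thesis by (simp add: add_ac)
  qed
  have cis_pos: "cis ((of_int (int j) * \<omega> 1 - \<omega> k) * t) = r * p ^ j" for j :: nat
    by (simp add: r_def p_def Complex.DeMoivre cis_mult algebra_simps)
  have cis_neg: "cis ((of_int (- int j) * \<omega> 1 - \<omega> k) * t) = r * (cnj p) ^ j" for j :: nat
  proof -
    have "r * (cnj p) ^ j = cis (- \<omega> k * t + real j * - (\<omega> 1 * t))"
      by (simp add: r_def p_def cis_cnj Complex.DeMoivre cis_mult)
    also have "\<dots> = cis ((of_int (- int j) * \<omega> 1 - \<omega> k) * t)"
      by (rule arg_cong[of _ _ cis]) (simp add: algebra_simps)
    finally show ?thesis ..
  qed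
  have cjs: "cis ((of_int 0 * \<omega> 1 - \<omega> k) * t) = r" "cis ((of_int 1 * \<omega> 1 - \<omega> k) * t) = r * p"
    "cis ((of_int 2 * \<omega> 1 - \<omega> k) * t) = r * p\<^sup>2" "cis ((of_int 3 * \<omega> 1 - \<omega> k) * t) = r * p ^ 3"
    "cis ((of_int (-1) * \<omega> 1 - \<omega> k) * t) = r * cnj p"
    "cis ((of_int (-2) * \<omega> 1 - \<omega> k) * t) = r * (cnj p)\<^sup>2"
    "cis ((of_int (-3) * \<omega> 1 - \<omega> k) * t) = r * (cnj p) ^ 3"
    using cis_pos[of 0] cis_pos[of 1] cis_pos[of 2] cis_pos[of 3] cis_neg[of 1] cis_neg[of 2] cis_neg[of 3]
    by simp_all
  have h: "harm \<epsilon> k 0 t z = - 2 * \<alpha> * (z * cnj z)"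
    "harm \<epsilon> k 1 t z = \<phi> * q + (- l) * z + (3 * \<i> * \<beta>) * (z * (z * cnj z))"
    "harm \<epsilon> k (-1) t z = \<phi> * cnj q + (- l) * cnj z + (- 3 * \<i> * \<beta>) * (cnj z * (z * cnj z))"
    "harm \<epsilon> k 2 t z = \<alpha> * (z * z)" "harm \<epsilon> k (-2) t z = \<alpha> * (cnj z * cnj z)"
    "harm \<epsilon> k 3 t z = (- \<i> * \<beta>) * (z * (z * z))"
    "harm \<epsilon> k (-3) t z = (\<i> * \<beta>) * (cnj z * (cnj z * cnj z))"
    unfolding harm_def Let_def \<alpha>_def \<beta>_def \<phi>_def l_def q_def by simp_all
  show ?thesis
    unfolding fr sum7 cjs h by (simp add: algebra_simps power2_eq_square power3_eq_cube)
qed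

section \<open>Resonant part and distance to the averaged equation\<close>

lemma continuous_on_harm:
  "continuous_on A B \<Longrightarrow> continuous_on A (\<lambda>t. harm \<epsilon> k j t (B t))"
  unfolding harm_def Let_def
  by (intro continuous_on_if_const continuous_intros)

text \<open>A pointwise bound is the slow bound for a constant function: \<open>B = z\<close> on
  \<open>{0..t}\<close> is slow with constant \<rho>. The modulus of \<open>N\<close> is taken
  because \<open>N\<close> could be negative when \<rho> is, as then no function is slow with
  constant \<rho>.\<close>

lemma harm_bounded:
  obtains M where "0 \<le> M"
    and "\<And>\<epsilon> t z. 0 \<le> \<epsilon> \<Longrightarrow> 0 \<le> t \<Longrightarrow> norm z \<le> \<rho> \<Longrightarrow> norm (harm \<epsilon> k j t z) \<le> M"
proof -
  obtain N where N: "\<And>\<epsilon> T B. 0 \<le> \<epsilon> \<Longrightarrow> slow \<epsilon> T \<rho> B \<Longrightarrow> slow \<epsilon> T N (\<lambda>t. harm \<epsilon> k j t (B t))"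
    using slow_op_harm[of \<rho> k j] unfolding slow_op_def by blast
  show ?thesis
  proof (rule that[of "\<bar>N\<bar>"])
    fix \<epsilon> t :: real and z :: complex assume a: "0 \<le> \<epsilon>" "0 \<le> t" "norm z \<le> \<rho>"
    have "slow \<epsilon> t \<rho> (\<lambda>_. z)"
      using slow_const a slow_mono by blast
    from N[OF a(1) this] show "norm (harm \<epsilon> k j t z) \<le> \<bar>N\<bar>"
      using a(2) unfolding slow_def by fastforce
  qed simp
qed

text \<open>The mean of the field over the fast oscillations: the frequency
  \<open>j \<omega>\<^sub>1 - \<omega>\<^sub>k\<close> vanishes only for
  \<open>j = k = 1\<close>.\<close>

definition avg :: "real \<Rightarrow> nat \<Rightarrow> real \<Rightarrow> complex \<Rightarrow> complex" where
  "avg \<epsilon> k t z = (if k = 1 then harm \<epsilon> 1 1 t z else 0)"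

text \<open>For \<open>k = 1\<close> the frequency is a nonzero multiple of
  \<open>\<omega> 1\<close>; otherwise its vanishing would be an integer relation in which
  \<open>\<omega> k\<close> has the coefficient -1.\<close>

lemma nonresonant:
  assumes k: "k \<in> {1..n}" and j: "j \<noteq> 1 \<or> k \<noteq> 1"
  shows "of_int j * \<omega> 1 - \<omega> k \<noteq> 0"
proof (cases "k = 1")
  case True
  then have "of_int j * \<omega> 1 - \<omega> k = of_int (j - 1) * \<omega> 1"
    by (simp add: algebra_simps)
  then show ?thesis
    using \<omega>_pos[OF one_mem] j True by simp
next
  case False
  show ?thesis
  proof
    assume "of_int j * \<omega> 1 - \<omega> k = 0"
    then have "of_int (-1) * \<omega> k + of_int j * \<omega> 1 = 0"
      by simp
    then show False
      using nonres[OF k False] unfolding Z_independent_def by (metis neg_equal_0_iff_equal one_neq_zero)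
  qed
qed

lemma oscillating_remainder:
  obtains N where "0 \<le> N"
    and "\<And>\<epsilon> T B k. 0 \<le> \<epsilon> \<Longrightarrow> slow \<epsilon> T M B \<Longrightarrow> k \<in> {1..n} \<Longrightarrow> small_primitive \<epsilon> T N
           (\<lambda>t. field \<epsilon> k t (\<lambda>i. if i = 1 then B t else 0) - avg \<epsilon> k t (B t))"
proof -
  have "\<exists>N. \<forall>\<epsilon> T B. 0 \<le> \<epsilon> \<longrightarrow> slow \<epsilon> T M B \<longrightarrow> slow \<epsilon> T N (\<lambda>t. harm \<epsilon> k j t (B t))" for k j
    using slow_op_harm[of M k j] unfolding slow_op_def by blast
  then obtain Nf where Nf: "\<And>k j \<epsilon> T B. 0 \<le> \<epsilon> \<Longrightarrow> slow \<epsilon> T M B \<Longrightarrow> slow \<epsilon> T (Nf k j) (\<lambda>t. harm \<epsilon> k j t (B t))"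
    by metis
  \<comment> \<open>For mode 1 the harmonic \<open>j = 1\<close> is left out: its frequency is 0 and
    its term is precisely \<open>avg\<close>.\<close>
  define J where "J k = {-3..3} - (if k = 1 then {1} else {} :: int set)" for k :: nat
  define \<mu> where "\<mu> k j = of_int j * \<omega> 1 - \<omega> k" for k :: nat and j :: int
  define N where "N k = (\<Sum>j\<in>J k. Nf k j / \<bar>\<mu> k j\<bar>)" for k
  show ?thesis
  \<comment> \<open>Absolute values, because nothing is known about the sign of the constants
    supplied by \<open>slow_op\<close>.\<close>
  proof (rule that[of "\<Sum>k=1..n. \<bar>N k\<bar>"])
    fix \<epsilon> T B k assume \<epsilon>: "0 \<le> \<epsilon>" and B: "slow \<epsilon> T M B" and k: "k \<in> {1..n}"
    have "field \<epsilon> k t (\<lambda>i. if i = 1 then B t else 0) - avg \<epsilon> k t (B t) =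
        (\<Sum>j\<in>J k. cis (\<mu> k j * t) * harm \<epsilon> k j t (B t))" for t
    proof (cases "k = 1")
      case True
      then show ?thesis
        unfolding field_harmonics[OF k] J_def avg_def by (simp add: sum_diff1 \<mu>_def)
    next
      case False
      then show ?thesis
        unfolding field_harmonics[OF k] J_def avg_def \<mu>_def by simp
    qed
    moreover have "small_primitive \<epsilon> T (N k) (\<lambda>t. \<Sum>j\<in>J k. cis (\<mu> k j * t) * harm \<epsilon> k j t (B t))"
      unfolding N_def
    proof (intro small_primitive_sum small_primitive_osc Nf \<epsilon> B)
      show "\<mu> k j \<noteq> 0" if "j \<in> J k" for j
        unfolding \<mu>_def using that by (intro nonresonant[OF k]) (auto simp: J_def split: if_splits)
    qed (simp add: J_def)
    ultimately have "small_primitive \<epsilon> T (N k)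
        (\<lambda>t. field \<epsilon> k t (\<lambda>i. if i = 1 then B t else 0) - avg \<epsilon> k t (B t))"
      by simp
    moreover have "N k \<le> (\<Sum>k=1..n. \<bar>N k\<bar>)"
      using member_le_sum[of k "{1..n}" "\<lambda>k. \<bar>N k\<bar>"] k by force
    ultimately show "small_primitive \<epsilon> T (\<Sum>k=1..n. \<bar>N k\<bar>)
        (\<lambda>t. field \<epsilon> k t (\<lambda>i. if i = 1 then B t else 0) - avg \<epsilon> k t (B t))"
      using small_primitive_mono \<epsilon> by blast
  qed (simp add: sum_nonneg)
qed

text \<open>The radii grow in steps of 1: \<open>B\<close> starts within \<rho> and stays within
  \<open>\<rho> + 1\<close>; the amplitudes start within \<open>\<rho> + 1\<close>, because
  \<open>\<epsilon> * N0 \<le> 1\<close>, and stay within \<open>\<rho> + 2\<close>. All estimates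
  hold for arbitrary given solutions, so \<open>\<gamma>0\<close> and \<open>K\<close> depend on the
  system, \<rho> and \<open>N0\<close> alone.\<close>

lemma amplitude_deviation:
  assumes \<rho>: "0 \<le> \<rho>" and N0: "0 \<le> N0"
  obtains \<gamma>0 K where "0 < \<gamma>0" and "0 \<le> K"
    and "\<And>\<gamma> \<epsilon> W B. 0 < \<gamma> \<Longrightarrow> \<gamma> \<le> \<gamma>0 \<Longrightarrow> 0 < \<epsilon> \<Longrightarrow> \<epsilon> * N0 \<le> 1 \<Longrightarrow>
      (\<And>k t. k \<in> {1..n} \<Longrightarrow> t \<in> {0..\<gamma> / \<epsilon>} \<Longrightarrow>
        (W k has_vector_derivative of_real \<epsilon> * field \<epsilon> k t (\<lambda>i. W i t)) (at t within {0..\<gamma> / \<epsilon>})) \<Longrightarrow>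
      (\<And>t. t \<in> {0..\<gamma> / \<epsilon>} \<Longrightarrow>
        (B has_vector_derivative of_real \<epsilon> * harm \<epsilon> 1 1 t (B t)) (at t within {0..\<gamma> / \<epsilon>})) \<Longrightarrow>
      norm (B 0) \<le> \<rho> \<Longrightarrow>
      (\<And>k. k \<in> {1..n} \<Longrightarrow> norm (W k 0 - (if k = 1 then B 0 else 0)) \<le> \<epsilon> * N0) \<Longrightarrow>
      (\<forall>k\<in>{1..n}. \<forall>t\<in>{0..\<gamma> / \<epsilon>}. norm (W k t) \<le> \<rho> + 2 \<and>
        norm (W k t - (if k = 1 then B t else 0)) \<le> \<epsilon> * K) \<and> slow \<epsilon> (\<gamma> / \<epsilon>) K B"
proof -
  have \<rho>2: "0 \<le> \<rho> + 2"
    using \<rho> by simp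
  obtain M where M: "0 \<le> M"
    "\<And>\<epsilon> k t w. k \<in> {1..n} \<Longrightarrow> (\<And>i. i \<in> {1..n} \<Longrightarrow> norm (w i) \<le> \<rho> + 2) \<Longrightarrow> \<bar>force \<epsilon> k t w\<bar> \<le> M"
    using force_bounded[OF \<rho>2] by blast
  obtain L where L: "0 \<le> L"
    "\<And>\<epsilon> k t w v e. k \<in> {1..n} \<Longrightarrow> (\<And>i. i \<in> {1..n} \<Longrightarrow> norm (w i) \<le> \<rho> + 2) \<Longrightarrow>
      (\<And>i. i \<in> {1..n} \<Longrightarrow> norm (v i) \<le> \<rho> + 2) \<Longrightarrow> (\<And>i. i \<in> {1..n} \<Longrightarrow> norm (w i - v i) \<le> e) \<Longrightarrow>
      norm (field \<epsilon> k t w - field \<epsilon> k t v) \<le> L * e"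
    using field_lipschitz[OF \<rho>2] by blast
  obtain H where H: "0 \<le> H"
    "\<And>\<epsilon> t z. 0 \<le> \<epsilon> \<Longrightarrow> 0 \<le> t \<Longrightarrow> norm z \<le> \<rho> + 1 \<Longrightarrow> norm (harm \<epsilon> 1 1 t z) \<le> H"
    using harm_bounded[of "\<rho> + 1" 1 1] by metis
  obtain N where N: "0 \<le> N"
    "\<And>\<epsilon> T B k. 0 \<le> \<epsilon> \<Longrightarrow> slow \<epsilon> T (\<rho> + 1 + H) B \<Longrightarrow> k \<in> {1..n} \<Longrightarrow> small_primitive \<epsilon> T N
           (\<lambda>t. field \<epsilon> k t (\<lambda>i. if i = 1 then B t else 0) - avg \<epsilon> k t (B t))"
    using oscillating_remainder[of "\<rho> + 1 + H"] by blast
  \<comment> \<open>Small enough that \<open>B\<close> and the amplitudes move by less than 1 and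
    that \<open>L * \<gamma>0 \<le> 1 / 2\<close>, as \<open>averaging_bound\<close>
    requires.\<close>
  define \<gamma>0 where "\<gamma>0 = 1 / (2 * (M + L + H + 1))"
  \<comment> \<open>The sum of the deviation bound and the slow bound of \<open>B\<close>, so that
    one constant serves both conclusions.\<close>
  define K where "K = 2 * (3 + \<gamma>0) * (N + N0) + (\<rho> + 1 + H)"
  have \<gamma>0: "0 < \<gamma>0" "M * \<gamma>0 < 1" "H * \<gamma>0 < 1" "L * \<gamma>0 \<le> 1 / 2"
    using M L H by (auto simp: \<gamma>0_def field_simps)
  have K0: "0 \<le> K" "\<rho> + 1 + H \<le> K" "2 * (3 + \<gamma>0) * (N + N0) \<le> K"
    using \<gamma>0 N N0 H \<rho> by (auto simp: K_def)
  show ?thesis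
  proof (rule that[OF \<gamma>0(1) K0(1)])
    fix \<gamma> \<epsilon> W B
    assume \<gamma>: "0 < \<gamma>" "\<gamma> \<le> \<gamma>0" and \<epsilon>: "0 < \<epsilon>" "\<epsilon> * N0 \<le> 1"
      and W: "\<And>k t. k \<in> {1..n} \<Longrightarrow> t \<in> {0..\<gamma> / \<epsilon>} \<Longrightarrow>
        (W k has_vector_derivative of_real \<epsilon> * field \<epsilon> k t (\<lambda>i. W i t)) (at t within {0..\<gamma> / \<epsilon>})"
      and B: "\<And>t. t \<in> {0..\<gamma> / \<epsilon>} \<Longrightarrow>
        (B has_vector_derivative of_real \<epsilon> * harm \<epsilon> 1 1 t (B t)) (at t within {0..\<gamma> / \<epsilon>})"
      and B0: "norm (B 0) \<le> \<rho>"
      and init: "\<And>k. k \<in> {1..n} \<Longrightarrow> norm (W k 0 - (if k = 1 then B 0 else 0)) \<le> \<epsilon> * N0"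
    define T where "T = \<gamma> / \<epsilon>"
    have T: "0 \<le> T" "\<epsilon> * T = \<gamma>"
      using \<gamma> \<epsilon> by (auto simp: T_def)
    note W = W[folded T_def] and B = B[folded T_def]
    have small: "\<epsilon> * x * T < 1" if "x * \<gamma>0 < 1" "0 \<le> x" for x
    proof -
      have "\<epsilon> * x * T = x * \<gamma>"
        using T(2) by (simp add: mult_ac)
      then show ?thesis
        using mult_left_mono[OF \<gamma>(2) that(2)] that(1) by linarith
    qed
    have Bdd: "norm (B t) \<le> \<rho> + 1" if t: "t \<in> {0..T}" for t
    proof -
      have "norm (B t - B 0) < 1"
      proof (rule bootstrap_ball[where I = "{()}" and W = "\<lambda>_. B" and M = "\<epsilon> * H"
            and W' = "\<lambda>_ t. of_real \<epsilon> * harm \<epsilon> 1 1 t (B t)"])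
        fix s and i :: unit assume s: "s \<in> {0..T}" and "\<And>i. i \<in> {()} \<Longrightarrow> norm (B s - B 0) \<le> 1"
        then have "norm (B s) \<le> \<rho> + 1"
          using B0 norm_triangle_sub[of "B s" "B 0"] by fastforce
        then have "norm (harm \<epsilon> 1 1 s (B s)) \<le> H"
          using s \<epsilon> by (intro H) auto
        then show "norm (of_real \<epsilon> * harm \<epsilon> 1 1 s (B s)) \<le> \<epsilon> * H"
          using \<epsilon> by (simp add: norm_mult)
      qed (use B T(1) t H(1) \<epsilon>(1) small[OF \<gamma>0(3) H(1)] in auto)
      then show ?thesis
        using B0 norm_triangle_sub[of "B t" "B 0"] by linarith
    qed
    have B_cont: "continuous_on {0..T} B"
      by (rule continuous_on_vector_derivative[OF B])
    have slow_B: "slow \<epsilon> T (\<rho> + 1 + H) B"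
      unfolding slow_def
    proof (intro conjI exI[of _ "\<lambda>t. of_real \<epsilon> * harm \<epsilon> 1 1 t (B t)"] ballI B)
      show "0 \<le> \<rho> + 1 + H" using \<rho> H by simp
      show "continuous_on {0..T} (\<lambda>t. of_real \<epsilon> * harm \<epsilon> 1 1 t (B t))"
        by (intro continuous_intros continuous_on_harm B_cont)
      fix t assume t: "t \<in> {0..T}"
      show "norm (B t) \<le> \<rho> + 1 + H"
        using Bdd[OF t] H by simp
      have "norm (harm \<epsilon> 1 1 t (B t)) \<le> \<rho> + 1 + H"
        using t \<epsilon> \<rho> H(2)[of \<epsilon> t "B t"] Bdd[OF t] by auto
      then show "norm (of_real \<epsilon> * harm \<epsilon> 1 1 t (B t)) \<le> \<epsilon> * (\<rho> + 1 + H)"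
        using \<epsilon> by (simp add: norm_mult del: distrib_left_numeral)
    qed
    have W0: "norm (W k 0) \<le> \<rho> + 1" if "k \<in> {1..n}" for k
    proof -
      have "norm (W k 0) \<le> norm (if k = 1 then B 0 else 0) + norm (W k 0 - (if k = 1 then B 0 else 0))"
        by (rule norm_triangle_sub)
      moreover have "norm (if k = 1 then B 0 else 0) \<le> \<rho>"
        using B0 \<rho> by simp
      ultimately show ?thesis
        using init[OF that] \<epsilon> by linarith
    qed
    have Wdd: "norm (W k t) \<le> \<rho> + 2" if k: "k \<in> {1..n}" and t: "t \<in> {0..T}" for k t
    proof -
      have "norm (W k t - W k 0) < 1"
      proof (rule bootstrap_ball[where I = "{1..n}" and W = W and M = "\<epsilon> * M" and T = T
            and W' = "\<lambda>k t. of_real \<epsilon> * field \<epsilon> k t (\<lambda>i. W i t)"])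
        fix s i assume s: "s \<in> {0..T}" and i: "i \<in> {1..n}"
          and small: "\<And>i. i \<in> {1..n} \<Longrightarrow> norm (W i s - W i 0) \<le> 1"
        have "norm (W i s) \<le> \<rho> + 2" if "i \<in> {1..n}" for i
          using W0[OF that] small[OF that] norm_triangle_sub[of "W i s" "W i 0"] by linarith
        then have "\<bar>force \<epsilon> i s (\<lambda>i. W i s)\<bar> \<le> M"
          by (intro M i)
        then show "norm (of_real \<epsilon> * field \<epsilon> i s (\<lambda>i. W i s)) \<le> \<epsilon> * M"
          using \<epsilon> by (simp add: norm_mult norm_field)
      qed (use k t W T(1) M(1) \<epsilon>(1) small[OF \<gamma>0(2) M(1)] in auto)
      then show ?thesis
        using W0[OF k] norm_triangle_sub[of "W k t" "W k 0"] by linarith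
    qed
    define V where "V i t = (if i = 1 then B t else 0)" for i :: nat and t
    have V: "(V k has_vector_derivative of_real \<epsilon> * avg \<epsilon> k t (B t)) (at t within {0..T})"
      if "t \<in> {0..T}" for k t
      using B[OF that] by (cases "k = 1") (simp_all add: V_def[abs_def] avg_def)
    have Vdd: "norm (V i t) \<le> \<rho> + 2" if "t \<in> {0..T}" for i t
      using Bdd[OF that] \<rho> by (auto simp: V_def)
    have dev: "norm (W k t - V k t) \<le> \<epsilon> * (2 * (3 + \<gamma>) * (N + N0))" if "k \<in> {1..n}" "t \<in> {0..T}" for k t
    \<comment> \<open>The difference of the field at the two amplitude vectors is the Lipschitz part
      \<open>Q\<close>; the field along \<open>(B, 0, ..., 0)\<close> minus its average is the
      oscillating part \<open>R\<close>.\<close>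
    proof (rule averaging_bound[where I = "{1..n}" and e = "\<lambda>k t. W k t - V k t" and T = T and L = L
          and Q = "\<lambda>k t. field \<epsilon> k t (\<lambda>i. W i t) - field \<epsilon> k t (\<lambda>i. V i t)"
          and R = "\<lambda>k t. field \<epsilon> k t (\<lambda>i. V i t) - avg \<epsilon> k t (B t)"])
      fix k t assume k: "k \<in> {1..n}" and t: "t \<in> {0..T}"
      have "((\<lambda>t. W k t - V k t) has_vector_derivative
          of_real \<epsilon> * field \<epsilon> k t (\<lambda>i. W i t) - of_real \<epsilon> * avg \<epsilon> k t (B t)) (at t within {0..T})"
        by (intro has_vector_derivative_diff W V k t)
      then show "((\<lambda>t. W k t - V k t) has_vector_derivative
          of_real \<epsilon> * (field \<epsilon> k t (\<lambda>i. W i t) - field \<epsilon> k t (\<lambda>i. V i t) +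
            (field \<epsilon> k t (\<lambda>i. V i t) - avg \<epsilon> k t (B t)))) (at t within {0..T})"
        by (simp add: algebra_simps)
      show "norm (field \<epsilon> k t (\<lambda>i. W i t) - field \<epsilon> k t (\<lambda>i. V i t)) \<le> L * S"
        if "\<And>i. i \<in> {1..n} \<Longrightarrow> norm (W i t - V i t) \<le> S" for S
        using that t by (intro L k Wdd Vdd)
    next
      fix k assume k: "k \<in> {1..n}"
      show "small_primitive \<epsilon> T (N + N0) (\<lambda>t. field \<epsilon> k t (\<lambda>i. V i t) - avg \<epsilon> k t (B t))"
        unfolding V_def using \<epsilon> N0 by (intro small_primitive_mono[OF N(2)[OF _ slow_B k]]) auto
      have "\<epsilon> * N0 \<le> \<epsilon> * (N + N0)"
        using N \<epsilon> by (intro mult_left_mono) auto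
      then show "norm (W k 0 - V k 0) \<le> \<epsilon> * (N + N0)"
        using init[OF k] by (simp add: V_def)
    next
      show "L * \<gamma> \<le> 1 / 2"
        using mult_left_mono[OF \<gamma>(2) L(1)] \<gamma>0(4) by linarith
    qed (use that \<epsilon> N N0 L T in auto)
    have "2 * (3 + \<gamma>) * (N + N0) \<le> K"
      using \<gamma> N N0 by (intro order_trans[OF _ K0(3)] mult_right_mono) auto
    then have "norm (W k t - V k t) \<le> \<epsilon> * K" if "k \<in> {1..n}" "t \<in> {0..T}" for k t
      using dev[OF that] \<epsilon> by (meson less_imp_le mult_left_mono order_trans)
    moreover have "slow \<epsilon> T K B"
      using slow_mono[OF slow_B K0(2)] \<epsilon> by simp
    ultimately show "(\<forall>k\<in>{1..n}. \<forall>t\<in>{0..\<gamma> / \<epsilon>}. norm (W k t) \<le> \<rho> + 2 \<and>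
        norm (W k t - (if k = 1 then B t else 0)) \<le> \<epsilon> * K) \<and> slow \<epsilon> (\<gamma> / \<epsilon>) K B"
      using Wdd by (auto simp: T_def V_def)
  qed
qed

end

section \<open>Regularity of the remainder\<close>

lemma C2_bounded_by_mono: "C2_bounded_by b S r \<Longrightarrow> b \<le> b' \<Longrightarrow> C2_bounded_by b' S r"
  unfolding C2_bounded_by_def by (meson order_trans)

text \<open>Two derivatives of the displacement are obtained from one derivative of
  \<open>E\<close>. The rotated \<open>F\<close> is real, so it drops out of the first derivative,
  and continuity of \<open>F\<close> is enough for the second. The drift \<open>h\<close> of the
  reference amplitude has no such property; it survives in the first derivative and is
  differentiated once more.\<close>

lemma C2_bounded_by_rotating:
  fixes E F h h' :: "real \<Rightarrow> complex"
  assumes \<mu>: "0 < \<mu>"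
    and E: "\<And>t. t \<in> S \<Longrightarrow> (E has_vector_derivative F t - h t) (at t)"
    and h: "\<And>t. t \<in> S \<Longrightarrow> (h has_vector_derivative h' t) (at t)"
    and F: "continuous_on S F" "\<And>t. t \<in> S \<Longrightarrow> Im (cis (\<mu> * t) * F t) = 0"
    and h': "continuous_on S h'"
    and bnd: "\<And>t. t \<in> S \<Longrightarrow> norm (E t) \<le> K" "\<And>t. t \<in> S \<Longrightarrow> norm (F t) \<le> K"
      "\<And>t. t \<in> S \<Longrightarrow> norm (h t) \<le> K" "\<And>t. t \<in> S \<Longrightarrow> norm (h' t) \<le> K"
    and K: "0 \<le> K"
  shows "C2_bounded_by (K * (4 + \<mu> + 1 / \<mu>)) S (\<lambda>t. Im (cis (\<mu> * t) * E t) / \<mu>)"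
proof -
  define r' where "r' t = Re (cis (\<mu> * t) * E t) - Im (cis (\<mu> * t) * h t) / \<mu>" for t
  define r'' where "r'' t = Re (cis (\<mu> * t) * (F t - h t) + \<i> * of_real \<mu> * cis (\<mu> * t) * E t)
     - Im (cis (\<mu> * t) * h' t + \<i> * of_real \<mu> * cis (\<mu> * t) * h t) / \<mu>" for t
  have cont: "continuous_on S E" "continuous_on S h"
    using E h by (meson continuous_at_imp_continuous_on has_vector_derivative_continuous)+
  have rot: "((\<lambda>t. cis (\<mu> * t) * G t) has_vector_derivative
      cis (\<mu> * t) * G' + \<i> * of_real \<mu> * cis (\<mu> * t) * G t) (at t)"
    if "(G has_vector_derivative G') (at t)" for G G' t
    by (intro has_vector_derivative_mult has_vector_derivative_cis that)
  have re: "((\<lambda>t. Re (G t)) has_real_derivative Re G') (at t)"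
    and im: "((\<lambda>t. Im (G t)) has_real_derivative Im G') (at t)"
    if "(G has_vector_derivative G') (at t)" for G G' t
    using that unfolding has_vector_derivative_complex_iff by auto
  have le: "\<bar>Re (cis a * z)\<bar> \<le> norm z" "\<bar>Im (cis a * z)\<bar> \<le> norm z" for a z
    using abs_Re_le_cmod[of "cis a * z"] abs_Im_le_cmod[of "cis a * z"]
    by (simp_all add: norm_mult del: times_complex.sel)
  show ?thesis
    unfolding C2_bounded_by_def
  proof (rule exI[of _ r'], rule exI[of _ r''], intro conjI ballI)
    show "continuous_on S r''"
      unfolding r''_def using \<mu> by (intro continuous_intros cont F h') auto
    fix t assume t: "t \<in> S"
    have "((\<lambda>t. Im (cis (\<mu> * t) * E t) / \<mu>) has_real_derivative
        Im (cis (\<mu> * t) * (F t - h t) + \<i> * of_real \<mu> * cis (\<mu> * t) * E t) / \<mu>) (at t)"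
      by (intro DERIV_cdivide im rot E t)
    moreover have "Im (cis (\<mu> * t) * (F t - h t) + \<i> * of_real \<mu> * cis (\<mu> * t) * E t) / \<mu> = r' t"
    proof -
      have "Im (cis (\<mu> * t) * (F t - h t) + \<i> * of_real \<mu> * cis (\<mu> * t) * E t) =
          Im (cis (\<mu> * t) * F t) - Im (cis (\<mu> * t) * h t) + \<mu> * Re (cis (\<mu> * t) * E t)"
        by (simp add: algebra_simps)
      then show ?thesis
        using F(2)[OF t] \<mu> by (simp add: r'_def diff_divide_distrib del: times_complex.sel)
    qed
    ultimately show "((\<lambda>t. Im (cis (\<mu> * t) * E t) / \<mu>) has_real_derivative r' t) (at t)"
      by simp
    show "(r' has_real_derivative r'' t) (at t)"
      unfolding r'_def r''_def by (intro DERIV_diff DERIV_cdivide re im rot E h t)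
    have K\<mu>: "0 \<le> K / \<mu>" "0 \<le> K * \<mu>"
      using K \<mu> by auto
    have dm: "\<bar>Im (cis a * z) / \<mu>\<bar> \<le> K / \<mu>" if "norm z \<le> K" for a z
      using le(2)[of a z] that \<mu> by (simp add: divide_right_mono del: times_complex.sel)
    \<comment> \<open>\<open>4 + \<mu> + 1 / \<mu>\<close> covers the longest sum, that of
      \<open>r''\<close>: three terms of size \<open>K\<close>, one with the factor \<mu> and one
      with 1 / \<mu>.\<close>
    have tot: "K * (4 + \<mu> + 1 / \<mu>) = 4 * K + K * \<mu> + K / \<mu>"
      by (simp add: algebra_simps)
    show "\<bar>Im (cis (\<mu> * t) * E t) / \<mu>\<bar> \<le> K * (4 + \<mu> + 1 / \<mu>)"
      unfolding tot using dm[OF bnd(1)[OF t], of "\<mu> * t"] K K\<mu> by linarith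
    show "\<bar>r' t\<bar> \<le> K * (4 + \<mu> + 1 / \<mu>)"
      unfolding tot r'_def using dm[OF bnd(3)[OF t], of "\<mu> * t"] le(1)[of "\<mu> * t" "E t"] bnd(1)[OF t] K K\<mu>
      by linarith
    have r''_eq: "r'' t = Re (cis (\<mu> * t) * F t) - 2 * Re (cis (\<mu> * t) * h t)
        - \<mu> * Im (cis (\<mu> * t) * E t) - Im (cis (\<mu> * t) * h' t) / \<mu>"
      using \<mu> by (simp add: r''_def field_simps)
    have "\<bar>\<mu> * Im (cis (\<mu> * t) * E t)\<bar> \<le> K * \<mu>"
      unfolding abs_mult using le(2)[of "\<mu> * t" "E t"] bnd(1)[OF t] \<mu> K
      by (subst mult.commute) (intro mult_mono, auto simp del: times_complex.sel)
    then show "\<bar>r'' t\<bar> \<le> K * (4 + \<mu> + 1 / \<mu>)"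
      unfolding tot r''_eq using dm[OF bnd(4)[OF t], of "\<mu> * t"] le(1)[of "\<mu> * t" "F t"]
        le(1)[of "\<mu> * t" "h t"] bnd(2,3)[OF t] K K\<mu> by linarith
  qed
qed

context modal_system begin

lemma cis_field: "cis (\<omega> k * t) * field \<epsilon> k t w = of_real (force \<epsilon> k t w)"
proof -
  have "cis (\<omega> k * t) * cis (- \<omega> k * t) = 1"
    by (simp add: cis_mult)
  then show ?thesis
    unfolding field_def by (metis mult.assoc mult_1)
qed

text \<open>Division by \<epsilon> turns the deviation into a function of order one whose derivative
  \<open>field - avg\<close> is again of order one, so \<open>C2_bounded_by_rotating\<close> applies
  with \<open>F = field\<close> and \<open>h = avg\<close>. The derivative of \<open>avg\<close>
  along \<open>B\<close> is bounded because \<open>harm\<close> maps slow functions to slow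
  ones.\<close>

lemma residual_C2:
  assumes \<rho>: "0 \<le> \<rho>" and K: "0 \<le> K"
  obtains C where
    "\<And>\<epsilon> T W B k. 0 < \<epsilon> \<Longrightarrow> \<epsilon> \<le> 1 \<Longrightarrow> k \<in> {1..n} \<Longrightarrow>
      (\<And>k t. k \<in> {1..n} \<Longrightarrow> t \<in> {0..T} \<Longrightarrow>
        (W k has_vector_derivative of_real \<epsilon> * field \<epsilon> k t (\<lambda>i. W i t)) (at t within {0..T})) \<Longrightarrow>
      (\<And>t. t \<in> {0..T} \<Longrightarrow>
        (B has_vector_derivative of_real \<epsilon> * harm \<epsilon> 1 1 t (B t)) (at t within {0..T})) \<Longrightarrow>
      (\<And>k t. k \<in> {1..n} \<Longrightarrow> t \<in> {0..T} \<Longrightarrow> norm (W k t) \<le> \<rho>) \<Longrightarrow>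
      (\<And>k t. k \<in> {1..n} \<Longrightarrow> t \<in> {0..T} \<Longrightarrow> norm (W k t - (if k = 1 then B t else 0)) \<le> \<epsilon> * K) \<Longrightarrow>
      slow \<epsilon> T K B \<Longrightarrow>
      C2_bounded_by C {0<..<T} (\<lambda>t. displ k t ((W k t - (if k = 1 then B t else 0)) / of_real \<epsilon>))"
proof -
  obtain M where M: "0 \<le> M"
    "\<And>\<epsilon> k t w. k \<in> {1..n} \<Longrightarrow> (\<And>i. i \<in> {1..n} \<Longrightarrow> norm (w i) \<le> \<rho>) \<Longrightarrow> \<bar>force \<epsilon> k t w\<bar> \<le> M"
    using force_bounded[OF \<rho>] by blast
  obtain N where N: "\<And>\<epsilon> T B. 0 \<le> \<epsilon> \<Longrightarrow> slow \<epsilon> T K B \<Longrightarrow> slow \<epsilon> T N (\<lambda>t. harm \<epsilon> 1 1 t (B t))"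
    using slow_op_harm[of K 1 1] unfolding slow_op_def by blast
  define K1 where "K1 = K + M + \<bar>N\<bar>"
  have K1: "0 \<le> K1" "K \<le> K1" "M \<le> K1" "N \<le> K1"
    using M K by (auto simp: K1_def)
  define C where "C k = K1 * (4 + \<omega> k + 1 / \<omega> k)" for k
  have C0: "0 \<le> C k" if "k \<in> {1..n}" for k
    using \<omega>_pos[OF that] K1(1) by (simp add: C_def)
  show ?thesis
  proof (rule that[of "\<Sum>k=1..n. C k"])
    fix \<epsilon> T W B k
    assume \<epsilon>: "0 < \<epsilon>" "\<epsilon> \<le> 1" and k: "k \<in> {1..n}"
      and W: "\<And>k t. k \<in> {1..n} \<Longrightarrow> t \<in> {0..T} \<Longrightarrow>
        (W k has_vector_derivative of_real \<epsilon> * field \<epsilon> k t (\<lambda>i. W i t)) (at t within {0..T})"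
      and B: "\<And>t. t \<in> {0..T} \<Longrightarrow>
        (B has_vector_derivative of_real \<epsilon> * harm \<epsilon> 1 1 t (B t)) (at t within {0..T})"
      and W\<rho>: "\<And>k t. k \<in> {1..n} \<Longrightarrow> t \<in> {0..T} \<Longrightarrow> norm (W k t) \<le> \<rho>"
      and dev: "\<And>k t. k \<in> {1..n} \<Longrightarrow> t \<in> {0..T} \<Longrightarrow> norm (W k t - (if k = 1 then B t else 0)) \<le> \<epsilon> * K"
      and sl: "slow \<epsilon> T K B"
    have "slow \<epsilon> T N (\<lambda>t. harm \<epsilon> 1 1 t (B t))"
      using N sl \<epsilon> by simp
    then obtain H where N0: "0 \<le> N" and H: "continuous_on {0..T} H"
      "\<And>t. t \<in> {0..T} \<Longrightarrow> ((\<lambda>t. harm \<epsilon> 1 1 t (B t)) has_vector_derivative H t) (at t within {0..T})"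
      "\<And>t. t \<in> {0..T} \<Longrightarrow> norm (harm \<epsilon> 1 1 t (B t)) \<le> N"
      "\<And>t. t \<in> {0..T} \<Longrightarrow> norm (H t) \<le> \<epsilon> * N"
      unfolding slow_def by blast
    have "C2_bounded_by (K1 * (4 + \<omega> k + 1 / \<omega> k)) {0<..<T}
        (\<lambda>t. Im (cis (\<omega> k * t) * ((W k t - (if k = 1 then B t else 0)) / of_real \<epsilon>)) / \<omega> k)"
    proof (rule C2_bounded_by_rotating[where F = "\<lambda>t. field \<epsilon> k t (\<lambda>i. W i t)"
          and h = "\<lambda>t. avg \<epsilon> k t (B t)" and h' = "\<lambda>t. if k = 1 then H t else 0"])
      show "0 < \<omega> k" "0 \<le> K1"
        using \<omega>_pos[OF k] K1 by auto
      show "continuous_on {0<..<T} (\<lambda>t. field \<epsilon> k t (\<lambda>i. W i t))"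
        by (rule continuous_on_subset[of "{0..T}"])
           (auto intro!: continuous_on_field k intro: continuous_on_vector_derivative[OF W])
      show "continuous_on {0<..<T} (\<lambda>t. if k = 1 then H t else 0)"
        by (intro continuous_on_if_const continuous_on_const continuous_on_subset[OF H(1)]) auto
    next
      fix t assume "t \<in> {0<..<T}"
      then have t: "t \<in> {0..T}" and at: "at t within {0..T} = at t"
        by (auto simp: at_within_Icc_at)
      have V: "((\<lambda>t. if k = 1 then B t else 0) has_vector_derivative of_real \<epsilon> * avg \<epsilon> k t (B t)) (at t)"
        using B[OF t] by (cases "k = 1") (simp_all add: avg_def at)
      have "((\<lambda>t. (W k t - (if k = 1 then B t else 0)) / of_real \<epsilon>) has_vector_derivative
          (of_real \<epsilon> * field \<epsilon> k t (\<lambda>i. W i t) - of_real \<epsilon> * avg \<epsilon> k t (B t)) / of_real \<epsilon>) (at t)"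
        using W[OF k t] V unfolding at
        by (intro has_vector_derivative_divide has_vector_derivative_diff)
      then show "((\<lambda>t. (W k t - (if k = 1 then B t else 0)) / of_real \<epsilon>) has_vector_derivative
          field \<epsilon> k t (\<lambda>i. W i t) - avg \<epsilon> k t (B t)) (at t)"
        using \<epsilon> by (simp add: diff_divide_distrib)
      show "((\<lambda>t. avg \<epsilon> k t (B t)) has_vector_derivative (if k = 1 then H t else 0)) (at t)"
        using H(2)[OF t] by (cases "k = 1") (simp_all add: avg_def at)
      show "Im (cis (\<omega> k * t) * field \<epsilon> k t (\<lambda>i. W i t)) = 0"
        unfolding cis_field by simp
      have "norm (W k t - (if k = 1 then B t else 0)) / \<epsilon> \<le> K"
        using dev[OF k t] \<epsilon> by (simp add: field_simps)
      then show "norm ((W k t - (if k = 1 then B t else 0)) / of_real \<epsilon>) \<le> K1"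
        using K1 \<epsilon> by (simp add: norm_divide)
      show "norm (field \<epsilon> k t (\<lambda>i. W i t)) \<le> K1"
        unfolding norm_field using M(2)[OF k, of "\<lambda>i. W i t" \<epsilon> t] W\<rho> t K1 by force
      show "norm (avg \<epsilon> k t (B t)) \<le> K1"
        unfolding avg_def using H(3)[OF t] K1 by auto
      have "\<epsilon> * N \<le> N"
        using \<epsilon> N0 by (simp add: mult_left_le_one_le)
      then show "norm (if k = 1 then H t else 0) \<le> K1"
        using H(4)[OF t] K1 by auto
    qed
    moreover have "C k \<le> (\<Sum>k=1..n. C k)"
      using C0 k by (intro member_le_sum) auto
    ultimately show "C2_bounded_by (\<Sum>k=1..n. C k) {0<..<T}
        (\<lambda>t. displ k t ((W k t - (if k = 1 then B t else 0)) / of_real \<epsilon>))"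
      unfolding displ_def C_def using C2_bounded_by_mono by blast
  qed
qed

section \<open>Translation between the modal equations, system (S) and the amplitudes\<close>

text \<open>For the displacement \<open>x = a cos \<theta>\<close> and the velocity
  \<open>v = - \<omega>\<^sub>1 a sin \<theta>\<close>, as in the prescribed initial data,
  \<open>v + \<i> \<omega>\<^sub>1 x\<close> equals
  \<open>\<i> \<omega>\<^sub>1 a exp (\<i> \<theta>)\<close>, which explains the factor \<i>.
  Rotating by \<open>- \<omega>\<^sub>1 t\<close> leaves the slow phase.\<close>

definition amplitude :: "real \<Rightarrow> (real \<Rightarrow> real) \<Rightarrow> (real \<Rightarrow> real) \<Rightarrow> real \<Rightarrow> complex" where
  "amplitude \<epsilon> a b t = \<i> * of_real (\<omega> 1 * a (\<epsilon> * t)) * cis (\<sigma> * (\<epsilon> * t) + b (\<epsilon> * t))"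

lemma displ_amplitude:
  "displ 1 t (amplitude \<epsilon> a b t) = a (\<epsilon> * t) * cos ((\<omega> 1 + \<epsilon> * \<sigma>) * t + b (\<epsilon> * t))"
proof -
  have "cis (\<omega> 1 * t) * amplitude \<epsilon> a b t =
      \<i> * of_real (\<omega> 1 * a (\<epsilon> * t)) * (cis (\<omega> 1 * t) * cis (\<sigma> * (\<epsilon> * t) + b (\<epsilon> * t)))"
    by (simp add: amplitude_def)
  also have "cis (\<omega> 1 * t) * cis (\<sigma> * (\<epsilon> * t) + b (\<epsilon> * t)) = cis ((\<omega> 1 + \<epsilon> * \<sigma>) * t + b (\<epsilon> * t))"
    by (simp add: cis_mult algebra_simps)
  finally show ?thesis
    using \<omega>_pos[OF one_mem] by (simp add: displ_def)
qed

text \<open>Once \<open>cis \<theta>\<close> is factored out, the imaginary part of the equation is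
  half the first equation of (S) and the real part is, up to sign, half the second one. The forcing
  phase becomes \<open>cis (- b)\<close>, and the cube contributes through
  \<open>A \<bar>A\<bar>\<^sup>2\<close>.\<close>

lemma amplitude_has_derivative:
  assumes mod: "modulation_solution (\<omega> 1) (lam 1) (f 1) \<sigma> d (D 1) {0..\<gamma>} a b"
    and \<epsilon>: "0 < \<epsilon>" and t: "t \<in> {0..\<gamma> / \<epsilon>}"
  shows "(amplitude \<epsilon> a b has_vector_derivative of_real \<epsilon> * harm \<epsilon> 1 1 t (amplitude \<epsilon> a b t))
           (at t within {0..\<gamma> / \<epsilon>})"
proof -
  let ?T = "{0..\<gamma> / \<epsilon>}"
  define s where "s = \<epsilon> * t"
  have "(*) \<epsilon> ` ?T = {0..\<gamma>}"
    using \<epsilon> by (simp add: image_mult_atLeastAtMost)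
  moreover have "s \<in> {0..\<gamma>}"
    using t \<epsilon> by (auto simp: s_def field_simps)
  \<comment> \<open>Derivatives within \<open>{0..\<gamma>}\<close> are one-sided at the ends;
    writing this interval as the image of \<open>?T\<close> lets the chain rule carry them
    over.\<close>
  ultimately obtain a' b' where
    ab: "(a has_real_derivative a') (at s within (*) \<epsilon> ` ?T)"
        "(b has_real_derivative b') (at s within (*) \<epsilon> ` ?T)"
    and eq1: "\<omega> 1 * (2 * a' + lam 1 * a s) = - f 1 * sin (b s)"
    and eq2: "2 * \<omega> 1 * (a s * b' + \<sigma> * a s) = 3 * d * a s ^ 3 / 4 * D 1 ^ 4 - f 1 * cos (b s)"
    using mod unfolding modulation_solution_def by metis
  have lin: "((*) \<epsilon> has_real_derivative \<epsilon>) (at t within ?T)"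
    by (auto intro!: derivative_eq_intros)
  have a_der: "((\<lambda>t. a (\<epsilon> * t)) has_real_derivative a' * \<epsilon>) (at t within ?T)"
    and b_der: "((\<lambda>t. b (\<epsilon> * t)) has_real_derivative b' * \<epsilon>) (at t within ?T)"
    using DERIV_image_chain[OF ab(1)[unfolded s_def] lin] DERIV_image_chain[OF ab(2)[unfolded s_def] lin]
    by (simp_all add: o_def)
  define \<theta> where "\<theta> t = \<sigma> * (\<epsilon> * t) + b (\<epsilon> * t)" for t
  have \<theta>_der: "(\<theta> has_real_derivative \<epsilon> * (\<sigma> + b')) (at t within ?T)"
    unfolding \<theta>_def by (rule derivative_eq_intros b_der refl)+ (simp add: algebra_simps)
  have cis_der: "((\<lambda>t. cis (\<theta> t)) has_vector_derivative of_real (\<epsilon> * (\<sigma> + b')) * (\<i> * cis (\<theta> t))) (at t within ?T)"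
    unfolding has_vector_derivative_complex_iff
    by (auto intro!: derivative_eq_intros \<theta>_der)
  have "(amplitude \<epsilon> a b has_vector_derivative
      \<i> * of_real (\<omega> 1 * a s) * (of_real (\<epsilon> * (\<sigma> + b')) * (\<i> * cis (\<theta> t))) +
      \<i> * of_real (\<omega> 1 * (a' * \<epsilon>)) * cis (\<theta> t)) (at t within ?T)"
    unfolding amplitude_def[abs_def] \<theta>_def[symmetric] s_def
    by (intro has_vector_derivative_mult cis_der has_vector_derivative_mult_right
        has_vector_derivative_of_real)
       (auto intro!: derivative_eq_intros a_der simp: has_real_derivative_iff_has_vector_derivative[symmetric])
  also have "\<i> * of_real (\<omega> 1 * a s) * (of_real (\<epsilon> * (\<sigma> + b')) * (\<i> * cis (\<theta> t))) +
      \<i> * of_real (\<omega> 1 * (a' * \<epsilon>)) * cis (\<theta> t) =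
      of_real \<epsilon> * (cis (\<theta> t) * Complex (- (\<omega> 1 * (a s * b' + \<sigma> * a s))) (\<omega> 1 * a'))"
    by (simp add: complex_eq_iff algebra_simps)
  also have "\<omega> 1 * (a s * b' + \<sigma> * a s) = 3 * d * a s ^ 3 / 8 * D 1 ^ 4 - f 1 / 2 * cos (b s)"
    using eq2 by simp
  also have "\<omega> 1 * a' = - f 1 / 2 * sin (b s) - lam 1 / 2 * (\<omega> 1 * a s)"
    using eq1 by (simp add: algebra_simps)
  also have "cis (\<theta> t) * Complex (- (3 * d * a s ^ 3 / 8 * D 1 ^ 4 - f 1 / 2 * cos (b s)))
      (- f 1 / 2 * sin (b s) - lam 1 / 2 * (\<omega> 1 * a s)) = harm \<epsilon> 1 1 t (amplitude \<epsilon> a b t)"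
  proof -
    define A where "A = amplitude \<epsilon> a b t"
    have A: "A = \<i> * of_real (\<omega> 1 * a s) * cis (\<theta> t)"
      by (simp add: A_def amplitude_def s_def \<theta>_def)
    have AA: "A * cnj A = of_real ((\<omega> 1 * a s)\<^sup>2)"
      unfolding complex_norm_square[symmetric] A by (simp add: norm_mult power_mult_distrib)
    have "cis (\<epsilon> * \<sigma> * t) = cis (\<theta> t) * cis (- b s)"
      by (simp add: cis_mult \<theta>_def s_def mult_ac)
    then have "harm \<epsilon> 1 1 t A = of_real (f 1 / 2) * (cis (\<theta> t) * cis (- b s)) + (- of_real (lam 1 / 2)) * A
        + 3 * \<i> * of_real (d * D 1 * D 1 ^ 3 / (8 * \<omega> 1 ^ 3)) * (A * of_real ((\<omega> 1 * a s)\<^sup>2))"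
      by (simp add: harm_def Let_def AA)
    also have "\<dots> = cis (\<theta> t) * (of_real (f 1 / 2) * cis (- b s) - of_real (lam 1 / 2) * (\<i> * of_real (\<omega> 1 * a s))
        - of_real (3 * (d * D 1 * D 1 ^ 3 / (8 * \<omega> 1 ^ 3)) * (\<omega> 1 * a s) * (\<omega> 1 * a s)\<^sup>2))"
      unfolding A by (simp add: algebra_simps)
    also have "3 * (d * D 1 * D 1 ^ 3 / (8 * \<omega> 1 ^ 3)) * (\<omega> 1 * a s) * (\<omega> 1 * a s)\<^sup>2 = 3 * d * a s ^ 3 / 8 * D 1 ^ 4"
      using \<omega>_pos[OF one_mem] by (simp add: field_simps power2_eq_square power3_eq_cube power4_eq_xxxx)
    also have "of_real (f 1 / 2) * cis (- b s) - of_real (lam 1 / 2) * (\<i> * of_real (\<omega> 1 * a s))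
        - of_real (3 * d * a s ^ 3 / 8 * D 1 ^ 4) =
        Complex (- (3 * d * a s ^ 3 / 8 * D 1 ^ 4 - f 1 / 2 * cos (b s))) (- f 1 / 2 * sin (b s) - lam 1 / 2 * (\<omega> 1 * a s))"
      by (simp add: complex_eq_iff)
    finally show ?thesis
      by (simp add: A_def)
  qed
  finally show ?thesis .
qed

text \<open>Variation of constants: for \<open>Z = y' + \<i> \<omega> y\<close> the combination
  \<open>Z' - \<i> \<omega> Z\<close> equals \<open>y'' + \<omega>\<^sup>2 y\<close>, so rotating by
  \<open>cis (- \<omega> t)\<close> removes the free oscillation and leaves the force.\<close>

lemma modal_solution_amplitudes:
  assumes sol: "modal_solution n \<omega> lam f D c d \<epsilon> (\<omega> 1 + \<epsilon> * \<sigma>) Y V T y" and \<epsilon>: "0 < \<epsilon>" and T: "0 \<le> T"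
  obtains W where "\<And>k t. k \<in> {1..n} \<Longrightarrow> t \<in> {0..T} \<Longrightarrow>
        (W k has_vector_derivative of_real \<epsilon> * field \<epsilon> k t (\<lambda>i. W i t)) (at t within {0..T})"
    and "\<And>k t. k \<in> {1..n} \<Longrightarrow> t \<in> {0..T} \<Longrightarrow> y k t = \<epsilon> * displ k t (W k t)"
    and "\<And>k. k \<in> {1..n} \<Longrightarrow> W k 0 = Complex (V k) (\<omega> k * Y k) / of_real \<epsilon>"
proof -
  from sol obtain y' y'' where y0: "\<And>k. k \<in> {1..n} \<Longrightarrow> y k 0 = Y k \<and> y' k 0 = V k"
    and y: "\<And>k t. k \<in> {1..n} \<Longrightarrow> t \<in> {0..T} \<Longrightarrow> (y k has_real_derivative y' k t) (at t within {0..T})"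
    and y': "\<And>k t. k \<in> {1..n} \<Longrightarrow> t \<in> {0..T} \<Longrightarrow> (y' k has_real_derivative y'' k t) (at t within {0..T})"
    and ode: "\<And>k t. k \<in> {1..n} \<Longrightarrow> t \<in> {0..T} \<Longrightarrow> y'' k t + \<epsilon> * lam k * y' k t + (\<omega> k)\<^sup>2 * y k t
            + D k * (c * (\<Sum>i=1..n. y i t * D i)\<^sup>2 + d / \<epsilon> * (\<Sum>i=1..n. y i t * D i) ^ 3)
          = \<epsilon>\<^sup>2 * f k * cos ((\<omega> 1 + \<epsilon> * \<sigma>) * t)"
    unfolding modal_solution_def by blast
  define Z where "Z k t = Complex (y' k t) (\<omega> k * y k t)" for k t
  define W where "W k t = cis (- \<omega> k * t) * Z k t / of_real \<epsilon>" for k t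
  have rot: "cis (\<omega> k * t) * W k t = Z k t / of_real \<epsilon>" for k t
  proof -
    have "cis (\<omega> k * t) * cis (- \<omega> k * t) = 1"
      by (simp add: cis_mult)
    then show ?thesis
      unfolding W_def by (metis mult.assoc mult_1 times_divide_eq_right)
  qed
  have disp: "displ k t (W k t) = y k t / \<epsilon>" if "k \<in> {1..n}" for k t
    unfolding displ_def rot using \<omega>_pos[OF that] \<epsilon> by (simp add: Z_def)
  have vel: "veloc k t (W k t) = y' k t / \<epsilon>" for k t
    unfolding veloc_def rot using \<epsilon> by (simp add: Z_def)
  have str: "stretch t (\<lambda>i. W i t) = (\<Sum>i=1..n. y i t * D i) / \<epsilon>" for t
    unfolding stretch_def sum_divide_distrib by (intro sum.cong) (auto simp: disp)
  have frc: "y'' k t + (\<omega> k)\<^sup>2 * y k t = \<epsilon>\<^sup>2 * force \<epsilon> k t (\<lambda>i. W i t)"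
    if "k \<in> {1..n}" "t \<in> {0..T}" for k t
  proof -
    have "\<epsilon>\<^sup>2 * (F - l * (v / \<epsilon>) - g * (c * (S / \<epsilon>)\<^sup>2 + d * (S / \<epsilon>) ^ 3)) =
        \<epsilon>\<^sup>2 * F - \<epsilon> * l * v - g * (c * S\<^sup>2 + d / \<epsilon> * S ^ 3)" for F l v g S
      using \<epsilon> by (simp add: field_simps power2_eq_square power3_eq_cube)
    then show ?thesis
      unfolding force_def vel str using ode[OF that] by (simp add: mult.assoc)
  qed
  show ?thesis
  proof (rule that[of W])
    fix k assume k: "k \<in> {1..n}"
    show "W k 0 = Complex (V k) (\<omega> k * Y k) / of_real \<epsilon>"
      using y0[OF k] by (simp add: W_def Z_def)
    fix t assume t: "t \<in> {0..T}"
    show "y k t = \<epsilon> * displ k t (W k t)"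
      using \<epsilon> by (simp add: disp[OF k])
    have Z: "(Z k has_vector_derivative Complex (y'' k t) (\<omega> k * y' k t)) (at t within {0..T})"
      unfolding has_vector_derivative_complex_iff Z_def
      using y[OF k t] y'[OF k t] by (auto intro!: derivative_eq_intros)
    have "(W k has_vector_derivative (cis (- \<omega> k * t) * Complex (y'' k t) (\<omega> k * y' k t) +
        \<i> * of_real (- \<omega> k) * cis (- \<omega> k * t) * Z k t) / of_real \<epsilon>) (at t within {0..T})"
      unfolding W_def[abs_def]
      by (intro has_vector_derivative_divide has_vector_derivative_mult has_vector_derivative_cis Z)
    also have "cis (- \<omega> k * t) * Complex (y'' k t) (\<omega> k * y' k t) +
        \<i> * of_real (- \<omega> k) * cis (- \<omega> k * t) * Z k t =
        cis (- \<omega> k * t) * (Complex (y'' k t) (\<omega> k * y' k t) - \<i> * of_real (\<omega> k) * Z k t)"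
      by (simp add: algebra_simps)
    also have "Complex (y'' k t) (\<omega> k * y' k t) - \<i> * of_real (\<omega> k) * Z k t =
        of_real (y'' k t + (\<omega> k)\<^sup>2 * y k t)"
      by (simp add: Z_def complex_eq_iff power2_eq_square)
    also have "cis (- \<omega> k * t) * of_real (y'' k t + (\<omega> k)\<^sup>2 * y k t) / of_real \<epsilon> =
        of_real \<epsilon> * field \<epsilon> k t (\<lambda>i. W i t)"
      unfolding frc[OF k t] field_def using \<epsilon> by (simp add: power2_eq_square)
    finally show "(W k has_vector_derivative of_real \<epsilon> * field \<epsilon> k t (\<lambda>i. W i t)) (at t within {0..T})" .
  qed
qed

text \<open>The converse passage, used for existence. The imaginary part of the rotated equation
  carries no force, since the force is real; this is why the displacement has \<open>veloc\<close>
  as its derivative.\<close>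

lemma modal_solution_of_amplitudes:
  assumes W: "\<And>k t. k \<in> {1..n} \<Longrightarrow> t \<in> {0..T} \<Longrightarrow>
        (W k has_vector_derivative of_real \<epsilon> * field \<epsilon> k t (\<lambda>i. W i t)) (at t within {0..T})"
    and W0: "\<And>k. k \<in> {1..n} \<Longrightarrow> W k 0 = Complex (V k) (\<omega> k * Y k) / of_real \<epsilon>"
    and \<epsilon>: "0 < \<epsilon>"
  shows "modal_solution n \<omega> lam f D c d \<epsilon> (\<omega> 1 + \<epsilon> * \<sigma>) Y V T (\<lambda>k t. \<epsilon> * displ k t (W k t))"
  unfolding modal_solution_def
proof (rule exI[of _ "\<lambda>k t. \<epsilon> * veloc k t (W k t)"],
    rule exI[of _ "\<lambda>k t. \<epsilon>\<^sup>2 * force \<epsilon> k t (\<lambda>i. W i t) - (\<omega> k)\<^sup>2 * (\<epsilon> * displ k t (W k t))"],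
    intro ballI conjI)
  fix k assume k: "k \<in> {1..n}"
  have \<omega>: "\<omega> k \<noteq> 0"
    using \<omega>_pos[OF k] by simp
  show "\<epsilon> * displ k 0 (W k 0) = Y k" "\<epsilon> * veloc k 0 (W k 0) = V k"
    unfolding W0[OF k] displ_def veloc_def using \<epsilon> \<omega> by simp_all
  fix t assume t: "t \<in> {0..T}"
  have "((\<lambda>t. cis (\<omega> k * t) * W k t) has_vector_derivative
      cis (\<omega> k * t) * (of_real \<epsilon> * field \<epsilon> k t (\<lambda>i. W i t)) + \<i> * of_real (\<omega> k) * cis (\<omega> k * t) * W k t) (at t within {0..T})"
    by (intro has_vector_derivative_mult has_vector_derivative_cis W k t)
  also have "cis (\<omega> k * t) * (of_real \<epsilon> * field \<epsilon> k t (\<lambda>i. W i t)) + \<i> * of_real (\<omega> k) * cis (\<omega> k * t) * W k t =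
      of_real (\<epsilon> * force \<epsilon> k t (\<lambda>i. W i t)) + \<i> * of_real (\<omega> k) * (cis (\<omega> k * t) * W k t)"
    using cis_field[of k t \<epsilon> "\<lambda>i. W i t"] by (simp add: mult.left_commute[of _ "of_real \<epsilon>"] mult.assoc)
  finally have der: "((\<lambda>t. cis (\<omega> k * t) * W k t) has_vector_derivative
      of_real (\<epsilon> * force \<epsilon> k t (\<lambda>i. W i t)) + \<i> * of_real (\<omega> k) * (cis (\<omega> k * t) * W k t)) (at t within {0..T})" .
  have re_im: "Re (of_real x + \<i> * of_real w * z) = x - w * Im z" "Im (of_real x + \<i> * of_real w * z) = w * Re z"
    for x w z by simp_all
  have rot: "((\<lambda>t. Re (cis (\<omega> k * t) * W k t)) has_real_derivative
        \<epsilon> * force \<epsilon> k t (\<lambda>i. W i t) - \<omega> k * Im (cis (\<omega> k * t) * W k t)) (at t within {0..T})"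
      "((\<lambda>t. Im (cis (\<omega> k * t) * W k t)) has_real_derivative \<omega> k * Re (cis (\<omega> k * t) * W k t)) (at t within {0..T})"
    using der unfolding has_vector_derivative_complex_iff re_im by blast+
  show "((\<lambda>t. \<epsilon> * displ k t (W k t)) has_real_derivative \<epsilon> * veloc k t (W k t)) (at t within {0..T})"
    using DERIV_cmult[OF DERIV_cdivide[OF rot(2), of "\<omega> k"], of \<epsilon>] \<omega> by (simp add: displ_def veloc_def)
  show "((\<lambda>t. \<epsilon> * veloc k t (W k t)) has_real_derivative
      \<epsilon>\<^sup>2 * force \<epsilon> k t (\<lambda>i. W i t) - (\<omega> k)\<^sup>2 * (\<epsilon> * displ k t (W k t))) (at t within {0..T})"
    unfolding veloc_def
    by (rule DERIV_cong[OF DERIV_cmult[OF rot(1), of \<epsilon>]])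
       (use \<omega> in \<open>simp add: displ_def field_simps power2_eq_square del: times_complex.sel\<close>)
  have str: "(\<Sum>i=1..n. \<epsilon> * displ i t (W i t) * D i) = \<epsilon> * stretch t (\<lambda>i. W i t)"
    by (simp add: stretch_def sum_distrib_left mult_ac)
  show "\<epsilon>\<^sup>2 * force \<epsilon> k t (\<lambda>i. W i t) - (\<omega> k)\<^sup>2 * (\<epsilon> * displ k t (W k t)) + \<epsilon> * lam k * (\<epsilon> * veloc k t (W k t)) +
      (\<omega> k)\<^sup>2 * (\<epsilon> * displ k t (W k t)) +
      D k * (c * (\<Sum>i=1..n. \<epsilon> * displ i t (W i t) * D i)\<^sup>2 + d / \<epsilon> * (\<Sum>i=1..n. \<epsilon> * displ i t (W i t) * D i) ^ 3) =
      \<epsilon>\<^sup>2 * f k * cos ((\<omega> 1 + \<epsilon> * \<sigma>) * t)"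
    unfolding str force_def using \<epsilon> by (simp add: field_simps power2_eq_square power3_eq_cube)
qed

end

section \<open>Existence of solutions\<close>

lemma abs_sin_diff_le: "\<bar>sin x - sin y\<bar> \<le> \<bar>x - y\<bar>" for x y :: real
  using field_differentiable_bound[of UNIV sin cos 1 x y] by (simp add: DERIV_sin)

lemma abs_cos_diff_le: "\<bar>cos x - cos y\<bar> \<le> \<bar>x - y\<bar>" for x y :: real
  using field_differentiable_bound[of UNIV cos "\<lambda>x. - sin x" 1 x y] by (simp add: DERIV_cos)

text \<open>Solved for the derivatives, (S) contains \<open>1 / a\<close>. Starting within
  \<open>\<bar>abar\<bar> / 4\<close> of \<open>abar\<close> and moving by at most
  \<open>\<bar>abar\<bar> / 4\<close>, \<open>a\<close> keeps a distance of at least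
  \<open>\<bar>abar\<bar> / 2\<close> from 0. The phase enters through sine and cosine only, so
  \<open>\<gamma>0\<close> can be chosen independently of \<beta>.\<close>

lemma modulation_solution_exists:
  fixes abar :: real
  assumes abar: "abar \<noteq> 0" and \<omega>: "0 < \<omega>"
  obtains \<gamma>0 where "0 < \<gamma>0"
    and "\<And>\<gamma> \<alpha> \<beta>. 0 < \<gamma> \<Longrightarrow> \<gamma> \<le> \<gamma>0 \<Longrightarrow> \<bar>\<alpha> - abar\<bar> \<le> \<bar>abar\<bar> / 4 \<Longrightarrow>
      \<exists>a b. modulation_solution \<omega> lam f \<sigma> d \<delta> {0..\<gamma>} a b \<and> a 0 = \<alpha> \<and> b 0 = \<beta>"
proof -
  define r m X where "r = \<bar>abar\<bar> / 4" and "m = \<bar>abar\<bar> / 2" and "X = 2 * \<bar>abar\<bar>"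
  \<comment> \<open>In solved form (S) is \<open>a' = - (lam / 2) a - q sin b\<close>,
    \<open>b' = P a\<^sup>2 - \<sigma> - q cos b / a\<close>; \<open>M\<close> bounds these
    right-hand sides and \<open>L\<close> is a Lipschitz constant for them.\<close>
  define q P where "q = f / (2 * \<omega>)" and "P = 3 * d * \<delta> ^ 4 / (8 * \<omega>)"
  define M where "M = \<bar>lam / 2\<bar> * X + \<bar>q\<bar> + \<bar>P\<bar> * X\<^sup>2 + \<bar>\<sigma>\<bar> + \<bar>q\<bar> / m"
  define L where "L = \<bar>lam / 2\<bar> + \<bar>q\<bar> + \<bar>P\<bar> * (2 * X) + \<bar>q\<bar> * (1 / m + 1 / m\<^sup>2)"
  have pos: "0 < r" "0 < m" "0 < X"
    using abar by (auto simp: r_def m_def X_def)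
  have nonneg: "0 \<le> M" "0 \<le> L"
    using pos by (auto simp: M_def L_def)
  define \<gamma>0 where "\<gamma>0 = min (r / (M + 1)) (1 / (L + 1))"
  have \<gamma>0: "0 < \<gamma>0" "M * \<gamma>0 \<le> r" "L * \<gamma>0 < 1"
  proof -
    show "0 < \<gamma>0"
      using pos nonneg by (auto simp: \<gamma>0_def)
    have "M * \<gamma>0 \<le> M * (r / (M + 1))" "L * \<gamma>0 \<le> L * (1 / (L + 1))"
      using nonneg unfolding \<gamma>0_def by (intro mult_left_mono min.cobounded1 min.cobounded2; simp)+
    moreover have "M * (r / (M + 1)) \<le> r" "L * (1 / (L + 1)) < 1"
      using nonneg pos by (auto simp: field_simps)
    ultimately show "M * \<gamma>0 \<le> r" "L * \<gamma>0 < 1" by auto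
  qed
  \<comment> \<open>Component 0 is the amplitude and component 1 the phase; all others stay
    constant.\<close>
  define F where "F k s w = (if k = 0 then - (lam / 2) * w 0 - q * sin (w 1)
      else if k = 1 then P * (w 0)\<^sup>2 - \<sigma> - q * (cos (w 1) / w 0) else 0)"
    for k :: nat and s :: real and w :: "nat \<Rightarrow> real"
  show ?thesis
  proof (rule that[OF \<gamma>0(1)])
    fix \<gamma> \<alpha> \<beta> assume \<gamma>: "0 < \<gamma>" "\<gamma> \<le> \<gamma>0" and \<alpha>: "\<bar>\<alpha> - abar\<bar> \<le> \<bar>abar\<bar> / 4"
    define w0 where "w0 k = (if k = 0 then \<alpha> else if k = 1 then \<beta> else 0)" for k :: nat
    have rng: "m \<le> \<bar>w 0\<bar>" "\<bar>w 0\<bar> \<le> X" if "\<And>i. norm (w i - w0 i) \<le> r" for w :: "nat \<Rightarrow> real"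
    proof -
      have "\<bar>w 0 - \<alpha>\<bar> \<le> \<bar>abar\<bar> / 4"
        using that[of 0] by (simp add: w0_def r_def)
      then show "m \<le> \<bar>w 0\<bar>" "\<bar>w 0\<bar> \<le> X"
        unfolding m_def X_def using \<alpha> by linarith+
    qed
    have Mg: "M * \<gamma> \<le> r" "L * \<gamma> < 1"
      using mult_left_mono[OF \<gamma>(2) nonneg(1)] mult_left_mono[OF \<gamma>(2) nonneg(2)] \<gamma>0 by auto
    obtain W where W0: "\<And>k. W k 0 = w0 k" and
      W: "\<And>k t. t \<in> {0..\<gamma>} \<Longrightarrow> (W k has_vector_derivative F k t (\<lambda>i. W i t)) (at t within {0..\<gamma>})" and
      Wr: "\<And>k t. t \<in> {0..\<gamma>} \<Longrightarrow> norm (W k t - w0 k) \<le> r"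
    proof (rule picard_on_ball[of \<gamma> r L w0 F M])
      fix k :: nat and s :: real and w :: "nat \<Rightarrow> real"
      assume w: "\<And>i. norm (w i - w0 i) \<le> r"
      have 1: "\<bar>lam / 2 * w 0\<bar> \<le> \<bar>lam / 2\<bar> * X"
        unfolding abs_mult using rng(2)[OF w] by (intro mult_left_mono) auto
      have 2: "\<bar>q * sin (w 1)\<bar> \<le> \<bar>q\<bar>"
        by (simp add: abs_mult mult_left_le)
      have 3: "\<bar>P * (w 0)\<^sup>2\<bar> \<le> \<bar>P\<bar> * X\<^sup>2"
        unfolding abs_mult power_abs using rng(2)[OF w] by (intro mult_left_mono power_mono) auto
      have 4: "\<bar>q * (cos (w 1) / w 0)\<bar> \<le> \<bar>q\<bar> / m"
      proof -
        have "\<bar>cos (w 1)\<bar> / \<bar>w 0\<bar> \<le> 1 / m"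
          using rng(1)[OF w] pos by (intro frac_le) auto
        then have "\<bar>q\<bar> * (\<bar>cos (w 1)\<bar> / \<bar>w 0\<bar>) \<le> \<bar>q\<bar> * (1 / m)"
          by (intro mult_left_mono) auto
        then show ?thesis by (simp add: abs_mult)
      qed
      have "0 \<le> \<bar>P\<bar> * X\<^sup>2" "0 \<le> \<bar>q\<bar> / m" "0 \<le> \<bar>lam / 2\<bar> * X"
        using pos by auto
      with 1 2 3 4 show "norm (F k s w) \<le> M"
        unfolding F_def M_def real_norm_def by (smt (verit) mult_minus_left)
    next
      fix k :: nat and s e :: real and w v :: "nat \<Rightarrow> real"
      assume w: "\<And>i. norm (w i - w0 i) \<le> r" and v: "\<And>i. norm (v i - w0 i) \<le> r"
        and e: "\<And>i. norm (w i - v i) \<le> e"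
      have e0: "0 \<le> e" "\<bar>w 0 - v 0\<bar> \<le> e" "\<bar>w 1 - v 1\<bar> \<le> e"
        using e[of 0] e[of 1] by auto
      have nz: "w 0 \<noteq> 0" "v 0 \<noteq> 0"
        using rng(1)[OF w] rng(1)[OF v] pos by auto
      have 1: "\<bar>lam / 2 * (w 0 - v 0)\<bar> \<le> \<bar>lam / 2\<bar> * e"
        unfolding abs_mult using e0 by (intro mult_left_mono) auto
      have 2: "\<bar>q * (sin (w 1) - sin (v 1))\<bar> \<le> \<bar>q\<bar> * e"
        unfolding abs_mult using e0 abs_sin_diff_le[of "w 1" "v 1"] by (intro mult_left_mono) auto
      have 3: "\<bar>P * ((w 0)\<^sup>2 - (v 0)\<^sup>2)\<bar> \<le> \<bar>P\<bar> * (2 * X) * e"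
      proof -
        have "\<bar>(w 0)\<^sup>2 - (v 0)\<^sup>2\<bar> = \<bar>w 0 + v 0\<bar> * \<bar>w 0 - v 0\<bar>"
          by (simp add: power2_eq_square algebra_simps flip: abs_mult)
        also have "\<dots> \<le> (2 * X) * e"
          using rng(2)[OF w] rng(2)[OF v] e0 pos by (intro mult_mono) auto
        finally show ?thesis
          unfolding abs_mult mult.assoc by (intro mult_left_mono) auto
      qed
      have 4: "\<bar>q * (cos (w 1) / w 0 - cos (v 1) / v 0)\<bar> \<le> \<bar>q\<bar> * (1 / m + 1 / m\<^sup>2) * e"
      proof -
        \<comment> \<open>Numerator and denominator are changed one after the other; this is the
          origin of \<open>1 / m + 1 / m\<^sup>2\<close> in \<open>L\<close>.\<close>
        have "cos (w 1) / w 0 - cos (v 1) / v 0 =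
            (cos (w 1) - cos (v 1)) / w 0 + cos (v 1) * ((v 0 - w 0) / (w 0 * v 0))"
          using nz by (simp add: field_simps)
        also have "\<bar>\<dots>\<bar> \<le> e / m + 1 * (e / (m * m))"
        proof (intro order_trans[OF abs_triangle_ineq] add_mono)
          show "\<bar>(cos (w 1) - cos (v 1)) / w 0\<bar> \<le> e / m"
            unfolding abs_divide using e0 rng(1)[OF w] pos abs_cos_diff_le[of "w 1" "v 1"]
            by (intro frac_le) auto
          have "\<bar>(v 0 - w 0) / (w 0 * v 0)\<bar> \<le> e / (m * m)"
            unfolding abs_divide abs_mult using e0 rng(1)[OF w] rng(1)[OF v] pos
            by (intro frac_le mult_mono) auto
          then show "\<bar>cos (v 1) * ((v 0 - w 0) / (w 0 * v 0))\<bar> \<le> 1 * (e / (m * m))"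
            unfolding abs_mult by (intro mult_mono) auto
        qed
        also have "\<dots> = (1 / m + 1 / m\<^sup>2) * e"
          by (simp add: power2_eq_square algebra_simps)
        finally show ?thesis
          unfolding abs_mult mult.assoc by (intro mult_left_mono) auto
      qed
      have Le: "L * e = \<bar>lam / 2\<bar> * e + \<bar>q\<bar> * e + \<bar>P\<bar> * (2 * X) * e + \<bar>q\<bar> * (1 / m + 1 / m\<^sup>2) * e"
        by (simp add: L_def algebra_simps)
      have nn: "0 \<le> \<bar>lam / 2\<bar> * e" "0 \<le> \<bar>q\<bar> * e" "0 \<le> \<bar>P\<bar> * (2 * X) * e" "0 \<le> \<bar>q\<bar> * (1 / m + 1 / m\<^sup>2) * e"
        using e0 pos by auto
      consider "k = 0" | "k = 1" | "k \<noteq> 0" "k \<noteq> 1" by blast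
      then show "norm (F k s w - F k s v) \<le> L * e"
      proof cases
        case 1
        have "F k s w - F k s v = - (lam / 2 * (w 0 - v 0)) - q * (sin (w 1) - sin (v 1))"
          by (simp add: F_def 1 field_simps)
        then show ?thesis
          using \<open>\<bar>lam / 2 * (w 0 - v 0)\<bar> \<le> \<bar>lam / 2\<bar> * e\<close> 2 nn unfolding Le real_norm_def by linarith
      next
        case 2
        have "F k s w - F k s v = P * ((w 0)\<^sup>2 - (v 0)\<^sup>2) - q * (cos (w 1) / w 0 - cos (v 1) / v 0)"
          by (simp add: F_def 2 algebra_simps)
        then have "\<bar>F k s w - F k s v\<bar> \<le>
            \<bar>P * ((w 0)\<^sup>2 - (v 0)\<^sup>2)\<bar> + \<bar>q * (cos (w 1) / w 0 - cos (v 1) / v 0)\<bar>"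
          by (simp only: abs_triangle_ineq4)
        also have "\<dots> \<le> \<bar>P\<bar> * (2 * X) * e + \<bar>q\<bar> * (1 / m + 1 / m\<^sup>2) * e"
          by (rule add_mono[OF 3 4])
        also have "\<dots> \<le> L * e"
          unfolding Le using nn by linarith
        finally show ?thesis
          by simp
      next
        case 3
        then show ?thesis
          using nn unfolding Le by (simp add: F_def)
      qed
    next
      fix k :: nat and W :: "nat \<Rightarrow> real \<Rightarrow> real"
      assume c: "\<And>i. continuous_on {0..\<gamma>} (W i)"
        and b: "\<And>i s. s \<in> {0..\<gamma>} \<Longrightarrow> norm (W i s - w0 i) \<le> r"
      have "\<forall>s\<in>{0..\<gamma>}. W 0 s \<noteq> 0"
      proof
        fix s assume "s \<in> {0..\<gamma>}"
        from rng(1)[of "\<lambda>i. W i s", OF b[OF this]] show "W 0 s \<noteq> 0"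
          using pos by auto
      qed
      then show "continuous_on {0..\<gamma>} (\<lambda>s. F k s (\<lambda>i. W i s))"
        unfolding F_def by (intro continuous_on_if_const continuous_intros c)
    qed (use \<gamma> pos nonneg Mg in auto)
    have "modulation_solution \<omega> lam f \<sigma> d \<delta> {0..\<gamma>} (W 0) (W 1)"
      unfolding modulation_solution_def
    proof (rule exI[of _ "\<lambda>s. F 0 s (\<lambda>i. W i s)"], rule exI[of _ "\<lambda>s. F 1 s (\<lambda>i. W i s)"], intro ballI conjI)
      fix s assume s: "s \<in> {0..\<gamma>}"
      show "(W 0 has_real_derivative F 0 s (\<lambda>i. W i s)) (at s within {0..\<gamma>})"
        "(W 1 has_real_derivative F 1 s (\<lambda>i. W i s)) (at s within {0..\<gamma>})"
        using W[OF s] by (simp_all add: has_real_derivative_iff_has_vector_derivative)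
      have "W 0 s \<noteq> 0"
        using rng(1)[of "\<lambda>i. W i s", OF Wr[OF s]] pos by auto
      then show "2 * \<omega> * (W 0 s * F 1 s (\<lambda>i. W i s) + \<sigma> * W 0 s) = 3 * d * W 0 s ^ 3 / 4 * \<delta> ^ 4 - f * cos (W 1 s)"
        using \<omega> by (simp add: F_def q_def P_def field_simps power2_eq_square power3_eq_cube)
      show "\<omega> * (2 * F 0 s (\<lambda>i. W i s) + lam * W 0 s) = - f * sin (W 1 s)"
        using \<omega> by (simp add: F_def q_def field_simps)
    qed
    moreover have "W 0 0 = \<alpha>" "W 1 0 = \<beta>"
      using W0[of 0] W0[of 1] by (simp_all add: w0_def)
    ultimately show "\<exists>a b. modulation_solution \<omega> lam f \<sigma> d \<delta> {0..\<gamma>} a b \<and> a 0 = \<alpha> \<and> b 0 = \<beta>"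
      by blast
  qed
qed

context modal_system begin

text \<open>\<open>\<gamma>0\<close> is independent of \<epsilon> because the field carries a factor
  \<epsilon> and time runs to \<gamma> / \<epsilon>, so \<epsilon> cancels in both smallness
  conditions of \<open>picard_on_ball\<close>.\<close>

lemma amplitudes_exist:
  assumes \<rho>: "0 \<le> \<rho>"
  obtains \<gamma>0 where "0 < \<gamma>0"
    and "\<And>\<gamma> \<epsilon> w0. 0 < \<gamma> \<Longrightarrow> \<gamma> \<le> \<gamma>0 \<Longrightarrow> 0 < \<epsilon> \<Longrightarrow> (\<And>k. k \<in> {1..n} \<Longrightarrow> norm (w0 k) \<le> \<rho>) \<Longrightarrow>
      \<exists>W. \<forall>k\<in>{1..n}. W k 0 = w0 k \<and> (\<forall>t\<in>{0..\<gamma> / \<epsilon>}.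
        (W k has_vector_derivative of_real \<epsilon> * field \<epsilon> k t (\<lambda>i. W i t)) (at t within {0..\<gamma> / \<epsilon>}))"
proof -
  have \<rho>1: "0 \<le> \<rho> + 1"
    using \<rho> by simp
  obtain M where M: "0 \<le> M"
    "\<And>\<epsilon> k t w. k \<in> {1..n} \<Longrightarrow> (\<And>i. i \<in> {1..n} \<Longrightarrow> norm (w i) \<le> \<rho> + 1) \<Longrightarrow> \<bar>force \<epsilon> k t w\<bar> \<le> M"
    using force_bounded[OF \<rho>1] by blast
  obtain L where L: "0 \<le> L"
    "\<And>\<epsilon> k t w v e. k \<in> {1..n} \<Longrightarrow> (\<And>i. i \<in> {1..n} \<Longrightarrow> norm (w i) \<le> \<rho> + 1) \<Longrightarrow>
      (\<And>i. i \<in> {1..n} \<Longrightarrow> norm (v i) \<le> \<rho> + 1) \<Longrightarrow> (\<And>i. i \<in> {1..n} \<Longrightarrow> norm (w i - v i) \<le> e) \<Longrightarrow>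
      norm (field \<epsilon> k t w - field \<epsilon> k t v) \<le> L * e"
    using field_lipschitz[OF \<rho>1] by blast
  define \<gamma>0 where "\<gamma>0 = 1 / (M + L + 1)"
  have \<gamma>0: "0 < \<gamma>0" "M * \<gamma>0 \<le> 1" "L * \<gamma>0 < 1"
    using M L by (auto simp: \<gamma>0_def field_simps)
  show ?thesis
  proof (rule that[OF \<gamma>0(1)])
    fix \<gamma> \<epsilon> :: real and w0 :: "nat \<Rightarrow> complex"
    assume \<gamma>: "0 < \<gamma>" "\<gamma> \<le> \<gamma>0" and \<epsilon>: "0 < \<epsilon>" and w0: "\<And>k. k \<in> {1..n} \<Longrightarrow> norm (w0 k) \<le> \<rho>"
    \<comment> \<open>Padding with zero beyond \<open>n\<close>, as \<open>picard_on_ball\<close>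
      has a component for every natural number.\<close>
    define F where "F k t w = (if k \<in> {1..n} then of_real \<epsilon> * field \<epsilon> k t w else 0)" for k t w
    have ball: "norm (w i) \<le> \<rho> + 1" if "norm (w i - w0 i) \<le> 1" "i \<in> {1..n}" for w i
      using w0[OF that(2)] that(1) norm_triangle_sub[of "w i" "w0 i"] by linarith
    have Mg: "\<epsilon> * M * (\<gamma> / \<epsilon>) \<le> 1" "\<epsilon> * L * (\<gamma> / \<epsilon>) < 1"
      using mult_left_mono[OF \<gamma>(2) M(1)] mult_left_mono[OF \<gamma>(2) L(1)] \<gamma>0 \<epsilon> by auto
    obtain W where W0: "\<And>k. W k 0 = w0 k" and
      W: "\<And>k t. t \<in> {0..\<gamma> / \<epsilon>} \<Longrightarrow> (W k has_vector_derivative F k t (\<lambda>i. W i t)) (at t within {0..\<gamma> / \<epsilon>})"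
    proof (rule picard_on_ball[of "\<gamma> / \<epsilon>" 1 "\<epsilon> * L" w0 F "\<epsilon> * M"])
      fix k and W :: "nat \<Rightarrow> real \<Rightarrow> complex"
      assume "\<And>i. continuous_on {0..\<gamma> / \<epsilon>} (W i)"
      then show "continuous_on {0..\<gamma> / \<epsilon>} (\<lambda>s. F k s (\<lambda>i. W i s))"
        unfolding F_def by (cases "k \<in> {1..n}") (auto intro!: continuous_intros continuous_on_field)
    next
      fix k s w assume "\<And>i. norm (w i - w0 i) \<le> 1"
      then show "norm (F k s w) \<le> \<epsilon> * M"
        using M(1) M(2)[of k w \<epsilon> s] ball \<epsilon> by (auto simp: F_def norm_mult norm_field)
    next
      fix k s w v e
      assume w: "\<And>i. norm (w i - w0 i) \<le> 1" and v: "\<And>i. norm (v i - w0 i) \<le> 1"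
        and e: "\<And>i. norm (w i - v i) \<le> e"
      have "0 \<le> e"
        using e[of 0] norm_ge_zero order_trans by blast
      moreover have "norm (field \<epsilon> k s w - field \<epsilon> k s v) \<le> L * e" if "k \<in> {1..n}"
        by (intro L that ball w v e)
      ultimately show "norm (F k s w - F k s v) \<le> \<epsilon> * L * e"
        using \<epsilon> L(1) by (auto simp: F_def norm_mult mult.assoc simp flip: right_diff_distrib)
    qed (use \<gamma> \<epsilon> M L Mg in auto)
    show "\<exists>W. \<forall>k\<in>{1..n}. W k 0 = w0 k \<and> (\<forall>t\<in>{0..\<gamma> / \<epsilon>}.
        (W k has_vector_derivative of_real \<epsilon> * field \<epsilon> k t (\<lambda>i. W i t)) (at t within {0..\<gamma> / \<epsilon>}))"
    proof (intro exI[of _ W] ballI conjI W0)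
      fix k t assume "k \<in> {1..n}" "t \<in> {0..\<gamma> / \<epsilon>}"
      then show "(W k has_vector_derivative of_real \<epsilon> * field \<epsilon> k t (\<lambda>i. W i t)) (at t within {0..\<gamma> / \<epsilon>})"
        using W[of t k] by (simp only: F_def if_True)
    qed
  qed
qed

end

section \<open>The asymptotic expansion\<close>

lemma bigo_at_right_0D:
  fixes g :: "real \<Rightarrow> real"
  assumes "g \<in> O[at_right 0](\<lambda>\<epsilon>. \<epsilon>\<^sup>2)"
  obtains A where "0 \<le> A" "\<forall>\<^sub>F \<epsilon> in at_right 0. \<bar>g \<epsilon>\<bar> \<le> A * \<epsilon>\<^sup>2"
  using assms unfolding bigo_def by (auto simp: abs_power2 intro: less_imp_le)

context modal_system begin

text \<open>Existence and expansion are proved separately: the expansion is shown for every pair of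
  solutions with the given data. Both \<gamma> and the bound on the remainders are fixed before
  \<epsilon>, since the lemmas above supply their constants uniformly.\<close>

lemma multiple_scales_expansion:
  fixes abar bbar C1 :: real and a0 b0 :: "real \<Rightarrow> real" and Y0 V0 :: "real \<Rightarrow> nat \<Rightarrow> real"
  assumes abar: "abar \<noteq> 0"
    and Y1: "(\<lambda>\<epsilon>. Y0 \<epsilon> 1 - \<epsilon> * a0 \<epsilon> * cos (b0 \<epsilon>)) \<in> O[at_right 0](\<lambda>\<epsilon>. \<epsilon>\<^sup>2)"
    and V1: "(\<lambda>\<epsilon>. V0 \<epsilon> 1 - (- \<epsilon> * \<omega> 1 * a0 \<epsilon> * sin (b0 \<epsilon>))) \<in> O[at_right 0](\<lambda>\<epsilon>. \<epsilon>\<^sup>2)"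
    and Yk: "\<And>k. k \<in> {1..n} \<Longrightarrow> k \<noteq> 1 \<Longrightarrow> (\<lambda>\<epsilon>. Y0 \<epsilon> k) \<in> O[at_right 0](\<lambda>\<epsilon>. \<epsilon>\<^sup>2)"
    and Vk: "\<And>k. k \<in> {1..n} \<Longrightarrow> k \<noteq> 1 \<Longrightarrow> \<forall>\<^sub>F \<epsilon> in at_right 0. V0 \<epsilon> k = 0"
    and a0: "\<forall>\<^sub>F \<epsilon> in at_right 0. \<bar>a0 \<epsilon> - abar\<bar> \<le> \<epsilon> * C1"
  shows "\<exists>\<gamma>>0. \<exists>B. \<forall>\<^sub>F \<epsilon> in at_right 0.
    (let \<Omega> = \<omega> 1 + \<epsilon> * \<sigma>;
         is_mod = (\<lambda>a b. modulation_solution (\<omega> 1) (lam 1) (f 1) \<sigma> d (D 1) {0..\<gamma>} a b \<and>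
                         a 0 = a0 \<epsilon> \<and> b 0 = b0 \<epsilon>);
         is_sol = modal_solution n \<omega> lam f D c d \<epsilon> \<Omega> (Y0 \<epsilon>) (V0 \<epsilon>) (\<gamma> / \<epsilon>)
     in (\<exists>a b. is_mod a b) \<and> (\<exists>y. is_sol y) \<and>
        (\<forall>a b y. is_mod a b \<longrightarrow> is_sol y \<longrightarrow>
          (\<exists>r. (\<forall>t\<in>{0..\<gamma> / \<epsilon>}.
                  y 1 t = \<epsilon> * a (\<epsilon> * t) * cos (\<Omega> * t + b (\<epsilon> * t)) + \<epsilon>\<^sup>2 * r 1 t \<and>
                  (\<forall>k\<in>{1..n}. k \<noteq> 1 \<longrightarrow> y k t = \<epsilon>\<^sup>2 * r k t)) \<and>
               (\<forall>k\<in>{1..n}. C2_bounded_by B {0<..<\<gamma> / \<epsilon>} (r k)))))"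
proof -
  \<comment> \<open>Initial amplitudes of the full system and, in \<open>B0\<close>, of the
    reference solution. The scaling divides by \<epsilon>, so errors
    \<open>O(\<epsilon>\<^sup>2)\<close> of the data become O(\<epsilon>) here.\<close>
  define W0 where "W0 \<epsilon> k = Complex (V0 \<epsilon> k) (\<omega> k * Y0 \<epsilon> k) / of_real \<epsilon>" for \<epsilon> k
  define B0 where "B0 \<epsilon> = \<i> * of_real (\<omega> 1 * a0 \<epsilon>) * cis (b0 \<epsilon>)" for \<epsilon>
  \<comment> \<open>For small \<epsilon>,
    \<open>\<bar>a0 \<epsilon>\<bar> \<le> 2 * \<bar>abar\<bar>\<close>, and the modulus of
    \<open>B0 \<epsilon>\<close> is \<open>\<omega> 1 * \<bar>a0 \<epsilon>\<bar>\<close>.\<close>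
  define \<rho> where "\<rho> = \<omega> 1 * (2 * \<bar>abar\<bar>)"
  have \<omega>1: "0 < \<omega> 1"
    by (rule \<omega>_pos[OF one_mem])
  have \<rho>: "0 \<le> \<rho>" "0 \<le> \<rho> + 1" "0 \<le> \<rho> + 2"
    using \<omega>1 by (auto simp: \<rho>_def)
  have pos: "\<forall>\<^sub>F \<epsilon> :: real in at_right 0. 0 < \<epsilon>"
    by (simp add: eventually_at_right_less)
  have small: "\<forall>\<^sub>F \<epsilon> :: real in at_right 0. \<epsilon> * x \<le> 1" for x
  proof -
    have "((\<lambda>\<epsilon>. \<epsilon> * x) \<longlongrightarrow> 0 * x) (at_right 0)"
      by (intro tendsto_intros)
    then have "\<forall>\<^sub>F \<epsilon> in at_right 0. \<epsilon> * x < 1"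
      by (rule order_tendstoD) simp
    then show ?thesis
      by (rule eventually_mono) simp
  qed
  have "\<exists>A. 0 \<le> A \<and> (\<forall>\<^sub>F \<epsilon> in at_right 0. norm (W0 \<epsilon> k - (if k = 1 then B0 \<epsilon> else 0)) \<le> \<epsilon> * A)"
    if k: "k \<in> {1..n}" for k
  proof (cases "k = 1")
    case True
    obtain A1 where A1: "0 \<le> A1" "\<forall>\<^sub>F \<epsilon> in at_right 0. \<bar>Y0 \<epsilon> 1 - \<epsilon> * a0 \<epsilon> * cos (b0 \<epsilon>)\<bar> \<le> A1 * \<epsilon>\<^sup>2"
      by (rule bigo_at_right_0D[OF Y1])
    obtain A2 where A2: "0 \<le> A2" "\<forall>\<^sub>F \<epsilon> in at_right 0. \<bar>V0 \<epsilon> 1 - (- \<epsilon> * \<omega> 1 * a0 \<epsilon> * sin (b0 \<epsilon>))\<bar> \<le> A2 * \<epsilon>\<^sup>2"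
      by (rule bigo_at_right_0D[OF V1])
    have "\<forall>\<^sub>F \<epsilon> in at_right 0. norm (W0 \<epsilon> k - (if k = 1 then B0 \<epsilon> else 0)) \<le> \<epsilon> * (A2 + \<omega> 1 * A1)"
      using A1(2) A2(2) pos
    proof eventually_elim
      case (elim \<epsilon>)
      have "W0 \<epsilon> 1 - B0 \<epsilon> = Complex (V0 \<epsilon> 1 - (- \<epsilon> * \<omega> 1 * a0 \<epsilon> * sin (b0 \<epsilon>)))
          (\<omega> 1 * (Y0 \<epsilon> 1 - \<epsilon> * a0 \<epsilon> * cos (b0 \<epsilon>))) / of_real \<epsilon>"
        using elim(3) by (simp add: W0_def B0_def complex_eq_iff field_simps)
      also have "norm \<dots> \<le> (A2 * \<epsilon>\<^sup>2 + \<omega> 1 * (A1 * \<epsilon>\<^sup>2)) / \<epsilon>"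
      proof -
        have "\<omega> 1 * \<bar>Y0 \<epsilon> 1 - \<epsilon> * a0 \<epsilon> * cos (b0 \<epsilon>)\<bar> \<le> \<omega> 1 * (A1 * \<epsilon>\<^sup>2)"
          using elim(1) \<omega>1 by (intro mult_left_mono) auto
        then have "norm (Complex (V0 \<epsilon> 1 - (- \<epsilon> * \<omega> 1 * a0 \<epsilon> * sin (b0 \<epsilon>)))
            (\<omega> 1 * (Y0 \<epsilon> 1 - \<epsilon> * a0 \<epsilon> * cos (b0 \<epsilon>)))) \<le> A2 * \<epsilon>\<^sup>2 + \<omega> 1 * (A1 * \<epsilon>\<^sup>2)"
          using elim(2) \<omega>1 cmod_le[of "Complex (V0 \<epsilon> 1 - (- \<epsilon> * \<omega> 1 * a0 \<epsilon> * sin (b0 \<epsilon>)))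
              (\<omega> 1 * (Y0 \<epsilon> 1 - \<epsilon> * a0 \<epsilon> * cos (b0 \<epsilon>)))"]
          by (simp only: complex.sel abs_mult[of "\<omega> 1"] abs_of_pos)
        then show ?thesis
          using elim(3) by (simp add: norm_divide divide_right_mono)
      qed
      also have "\<dots> = \<epsilon> * (A2 + \<omega> 1 * A1)"
        using elim(3) by (simp add: field_simps power2_eq_square)
      finally show ?case
        using True by simp
    qed
    then show ?thesis
      using A1(1) A2(1) \<omega>1 by (intro exI[of _ "A2 + \<omega> 1 * A1"]) auto
  next
    case False
    obtain A where A: "0 \<le> A" "\<forall>\<^sub>F \<epsilon> in at_right 0. \<bar>Y0 \<epsilon> k\<bar> \<le> A * \<epsilon>\<^sup>2"
      by (rule bigo_at_right_0D[OF Yk[OF k False]])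
    have "\<forall>\<^sub>F \<epsilon> in at_right 0. norm (W0 \<epsilon> k - (if k = 1 then B0 \<epsilon> else 0)) \<le> \<epsilon> * (\<omega> k * A)"
      using A(2) Vk[OF k False] pos
    proof eventually_elim
      case (elim \<epsilon>)
      have "norm (W0 \<epsilon> k) = \<omega> k * \<bar>Y0 \<epsilon> k\<bar> / \<epsilon>"
        using elim(2,3) \<omega>_pos[OF k] by (simp add: W0_def norm_divide complex_norm abs_mult)
      also have "\<dots> \<le> \<omega> k * (A * \<epsilon>\<^sup>2) / \<epsilon>"
        using elim(1,3) \<omega>_pos[OF k] by (intro divide_right_mono mult_left_mono) auto
      also have "\<dots> = \<epsilon> * (\<omega> k * A)"
        using elim(3) by (simp add: power2_eq_square)
      finally show ?case
        using False by simp
    qed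
    then show ?thesis
      using A(1) \<omega>_pos[OF k] by (intro exI[of _ "\<omega> k * A"]) auto
  qed
  then obtain A where A: "\<And>k. k \<in> {1..n} \<Longrightarrow> 0 \<le> A k"
    "\<And>k. k \<in> {1..n} \<Longrightarrow> \<forall>\<^sub>F \<epsilon> in at_right 0. norm (W0 \<epsilon> k - (if k = 1 then B0 \<epsilon> else 0)) \<le> \<epsilon> * A k"
    by metis
  define N0 where "N0 = (\<Sum>k=1..n. A k)"
  have N0: "0 \<le> N0" "A k \<le> N0" if "k \<in> {1..n}" for k
    unfolding N0_def using A(1) that by (auto intro!: sum_nonneg member_le_sum)
  obtain \<gamma>1 K where \<gamma>1: "0 < \<gamma>1" and K: "0 \<le> K"
    and deviation: "\<And>\<gamma> \<epsilon> W B. 0 < \<gamma> \<Longrightarrow> \<gamma> \<le> \<gamma>1 \<Longrightarrow> 0 < \<epsilon> \<Longrightarrow> \<epsilon> * N0 \<le> 1 \<Longrightarrow>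
      (\<And>k t. k \<in> {1..n} \<Longrightarrow> t \<in> {0..\<gamma> / \<epsilon>} \<Longrightarrow>
        (W k has_vector_derivative of_real \<epsilon> * field \<epsilon> k t (\<lambda>i. W i t)) (at t within {0..\<gamma> / \<epsilon>})) \<Longrightarrow>
      (\<And>t. t \<in> {0..\<gamma> / \<epsilon>} \<Longrightarrow>
        (B has_vector_derivative of_real \<epsilon> * harm \<epsilon> 1 1 t (B t)) (at t within {0..\<gamma> / \<epsilon>})) \<Longrightarrow>
      norm (B 0) \<le> \<rho> \<Longrightarrow>
      (\<And>k. k \<in> {1..n} \<Longrightarrow> norm (W k 0 - (if k = 1 then B 0 else 0)) \<le> \<epsilon> * N0) \<Longrightarrow>
      (\<forall>k\<in>{1..n}. \<forall>t\<in>{0..\<gamma> / \<epsilon>}. norm (W k t) \<le> \<rho> + 2 \<and>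
        norm (W k t - (if k = 1 then B t else 0)) \<le> \<epsilon> * K) \<and> slow \<epsilon> (\<gamma> / \<epsilon>) K B"
    using amplitude_deviation[OF \<rho>(1) N0(1)[OF one_mem]] by blast
  obtain Cb where residual: "\<And>\<epsilon> T W B k. 0 < \<epsilon> \<Longrightarrow> \<epsilon> \<le> 1 \<Longrightarrow> k \<in> {1..n} \<Longrightarrow>
      (\<And>k t. k \<in> {1..n} \<Longrightarrow> t \<in> {0..T} \<Longrightarrow>
        (W k has_vector_derivative of_real \<epsilon> * field \<epsilon> k t (\<lambda>i. W i t)) (at t within {0..T})) \<Longrightarrow>
      (\<And>t. t \<in> {0..T} \<Longrightarrow>
        (B has_vector_derivative of_real \<epsilon> * harm \<epsilon> 1 1 t (B t)) (at t within {0..T})) \<Longrightarrow>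
      (\<And>k t. k \<in> {1..n} \<Longrightarrow> t \<in> {0..T} \<Longrightarrow> norm (W k t) \<le> \<rho> + 2) \<Longrightarrow>
      (\<And>k t. k \<in> {1..n} \<Longrightarrow> t \<in> {0..T} \<Longrightarrow> norm (W k t - (if k = 1 then B t else 0)) \<le> \<epsilon> * K) \<Longrightarrow>
      slow \<epsilon> T K B \<Longrightarrow>
      C2_bounded_by Cb {0<..<T} (\<lambda>t. displ k t ((W k t - (if k = 1 then B t else 0)) / of_real \<epsilon>))"
    using residual_C2[OF \<rho>(3) K] by blast
  obtain \<gamma>2 where \<gamma>2: "0 < \<gamma>2" and modal_ex: "\<And>\<gamma> \<epsilon> w0. 0 < \<gamma> \<Longrightarrow> \<gamma> \<le> \<gamma>2 \<Longrightarrow> 0 < \<epsilon> \<Longrightarrow>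
      (\<And>k. k \<in> {1..n} \<Longrightarrow> norm (w0 k) \<le> \<rho> + 1) \<Longrightarrow>
      \<exists>W. \<forall>k\<in>{1..n}. W k 0 = w0 k \<and> (\<forall>t\<in>{0..\<gamma> / \<epsilon>}.
        (W k has_vector_derivative of_real \<epsilon> * field \<epsilon> k t (\<lambda>i. W i t)) (at t within {0..\<gamma> / \<epsilon>}))"
    using amplitudes_exist[OF \<rho>(2)] by blast
  obtain \<gamma>3 where \<gamma>3: "0 < \<gamma>3" and mod_ex: "\<And>\<gamma> \<alpha> \<beta>. 0 < \<gamma> \<Longrightarrow> \<gamma> \<le> \<gamma>3 \<Longrightarrow> \<bar>\<alpha> - abar\<bar> \<le> \<bar>abar\<bar> / 4 \<Longrightarrow>
      \<exists>a b. modulation_solution (\<omega> 1) (lam 1) (f 1) \<sigma> d (D 1) {0..\<gamma>} a b \<and> a 0 = \<alpha> \<and> b 0 = \<beta>"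
    using modulation_solution_exists[OF abar \<omega>1, where lam = "lam 1" and f = "f 1" and \<sigma> = \<sigma> and d = d and \<delta> = "D 1"] by blast
  define \<gamma> where "\<gamma> = min \<gamma>1 (min \<gamma>2 \<gamma>3)"
  have \<gamma>: "0 < \<gamma>" "\<gamma> \<le> \<gamma>1" "\<gamma> \<le> \<gamma>2" "\<gamma> \<le> \<gamma>3"
    using \<gamma>1 \<gamma>2 \<gamma>3 by (auto simp: \<gamma>_def)
  have W0_ev: "\<forall>\<^sub>F \<epsilon> in at_right 0. \<forall>k\<in>{1..n}. norm (W0 \<epsilon> k - (if k = 1 then B0 \<epsilon> else 0)) \<le> \<epsilon> * A k"
    using A(2) by (intro eventually_ball_finite) auto
  show ?thesis
    unfolding Let_def
  proof (rule exI[of _ \<gamma>], intro conjI \<gamma>, rule exI[of _ Cb])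
    show "\<forall>\<^sub>F \<epsilon> in at_right 0.
      (\<exists>a b. modulation_solution (\<omega> 1) (lam 1) (f 1) \<sigma> d (D 1) {0..\<gamma>} a b \<and> a 0 = a0 \<epsilon> \<and> b 0 = b0 \<epsilon>) \<and>
      (\<exists>y. modal_solution n \<omega> lam f D c d \<epsilon> (\<omega> 1 + \<epsilon> * \<sigma>) (Y0 \<epsilon>) (V0 \<epsilon>) (\<gamma> / \<epsilon>) y) \<and>
      (\<forall>a b y. modulation_solution (\<omega> 1) (lam 1) (f 1) \<sigma> d (D 1) {0..\<gamma>} a b \<and> a 0 = a0 \<epsilon> \<and> b 0 = b0 \<epsilon> \<longrightarrow>
        modal_solution n \<omega> lam f D c d \<epsilon> (\<omega> 1 + \<epsilon> * \<sigma>) (Y0 \<epsilon>) (V0 \<epsilon>) (\<gamma> / \<epsilon>) y \<longrightarrow>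
        (\<exists>r. (\<forall>t\<in>{0..\<gamma> / \<epsilon>}.
                y 1 t = \<epsilon> * a (\<epsilon> * t) * cos ((\<omega> 1 + \<epsilon> * \<sigma>) * t + b (\<epsilon> * t)) + \<epsilon>\<^sup>2 * r 1 t \<and>
                (\<forall>k\<in>{1..n}. k \<noteq> 1 \<longrightarrow> y k t = \<epsilon>\<^sup>2 * r k t)) \<and>
             (\<forall>k\<in>{1..n}. C2_bounded_by Cb {0<..<\<gamma> / \<epsilon>} (r k))))"
      \<comment> \<open>Thresholds for \<epsilon>: \<open>\<epsilon> \<le> 1\<close> for
        \<open>residual\<close>, \<open>\<epsilon> * N0 \<le> 1\<close> for the radii in
        \<open>deviation\<close>, and the third, with the bound on \<open>a0\<close>, puts
        \<open>a0 \<epsilon>\<close> within \<open>\<bar>abar\<bar> / 4\<close> of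
        \<open>abar\<close>, where (S) can be solved.\<close>
      using pos small[of 1] small[of N0] small[of "C1 * 4 / \<bar>abar\<bar>"] a0 W0_ev
    proof eventually_elim
      case (elim \<epsilon>)
      have "\<epsilon> * C1 \<le> \<bar>abar\<bar> / 4"
        using elim(4) abar by (simp add: field_simps)
      then have a0_near: "\<bar>a0 \<epsilon> - abar\<bar> \<le> \<bar>abar\<bar> / 4"
        using elim(5) by linarith
      then have "\<bar>a0 \<epsilon>\<bar> \<le> 2 * \<bar>abar\<bar>"
        by linarith
      then have B0: "norm (B0 \<epsilon>) \<le> \<rho>"
        using \<omega>1 by (simp add: B0_def \<rho>_def norm_mult abs_mult)
      have init: "norm (W0 \<epsilon> k - (if k = 1 then B0 \<epsilon> else 0)) \<le> \<epsilon> * N0" if "k \<in> {1..n}" for k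
        using bspec[OF elim(6) that] mult_left_mono[OF N0(2)[OF that], of \<epsilon>] elim(1) by linarith
      have "norm (W0 \<epsilon> k) \<le> \<rho> + 1" if "k \<in> {1..n}" for k
      proof -
        have "norm (if k = 1 then B0 \<epsilon> else 0) \<le> \<rho>"
          using B0 \<rho> by simp
        moreover note norm_triangle_sub[of "W0 \<epsilon> k" "if k = 1 then B0 \<epsilon> else 0"] init[OF that] elim(3)
        ultimately show ?thesis by linarith
      qed
      then obtain W where "\<forall>k\<in>{1..n}. W k 0 = W0 \<epsilon> k \<and> (\<forall>t\<in>{0..\<gamma> / \<epsilon>}.
          (W k has_vector_derivative of_real \<epsilon> * field \<epsilon> k t (\<lambda>i. W i t)) (at t within {0..\<gamma> / \<epsilon>}))"
        using modal_ex[OF \<gamma>(1,3) elim(1), of "W0 \<epsilon>"] by blast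
      then have "modal_solution n \<omega> lam f D c d \<epsilon> (\<omega> 1 + \<epsilon> * \<sigma>) (Y0 \<epsilon>) (V0 \<epsilon>) (\<gamma> / \<epsilon>)
          (\<lambda>k t. \<epsilon> * displ k t (W k t))"
        by (intro modal_solution_of_amplitudes elim(1)) (auto simp: W0_def)
      then have ex_sol: "\<exists>y. modal_solution n \<omega> lam f D c d \<epsilon> (\<omega> 1 + \<epsilon> * \<sigma>) (Y0 \<epsilon>) (V0 \<epsilon>) (\<gamma> / \<epsilon>) y"
        by blast
      show ?case
      proof (intro conjI mod_ex[OF \<gamma>(1,4) a0_near] ex_sol allI impI, elim conjE)
        fix a b y
        assume md: "modulation_solution (\<omega> 1) (lam 1) (f 1) \<sigma> d (D 1) {0..\<gamma>} a b"
          and ab0: "a 0 = a0 \<epsilon>" "b 0 = b0 \<epsilon>"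
          and sol: "modal_solution n \<omega> lam f D c d \<epsilon> (\<omega> 1 + \<epsilon> * \<sigma>) (Y0 \<epsilon>) (V0 \<epsilon>) (\<gamma> / \<epsilon>) y"
        define B where "B = amplitude \<epsilon> a b"
        have B: "(B has_vector_derivative of_real \<epsilon> * harm \<epsilon> 1 1 t (B t)) (at t within {0..\<gamma> / \<epsilon>})"
          if "t \<in> {0..\<gamma> / \<epsilon>}" for t
          unfolding B_def by (rule amplitude_has_derivative[OF md elim(1) that])
        have B_0: "B 0 = B0 \<epsilon>"
          by (simp add: B_def amplitude_def B0_def ab0)
        have T: "0 \<le> \<gamma> / \<epsilon>"
          using \<gamma>(1) elim(1) by simp
        obtain W where W: "\<And>k t. k \<in> {1..n} \<Longrightarrow> t \<in> {0..\<gamma> / \<epsilon>} \<Longrightarrow>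
            (W k has_vector_derivative of_real \<epsilon> * field \<epsilon> k t (\<lambda>i. W i t)) (at t within {0..\<gamma> / \<epsilon>})"
          and yW: "\<And>k t. k \<in> {1..n} \<Longrightarrow> t \<in> {0..\<gamma> / \<epsilon>} \<Longrightarrow> y k t = \<epsilon> * displ k t (W k t)"
          and W_0: "\<And>k. k \<in> {1..n} \<Longrightarrow> W k 0 = Complex (V0 \<epsilon> k) (\<omega> k * Y0 \<epsilon> k) / of_real \<epsilon>"
          using modal_solution_amplitudes[OF sol elim(1) T] by blast
        have dev: "(\<forall>k\<in>{1..n}. \<forall>t\<in>{0..\<gamma> / \<epsilon>}. norm (W k t) \<le> \<rho> + 2 \<and>
            norm (W k t - (if k = 1 then B t else 0)) \<le> \<epsilon> * K) \<and> slow \<epsilon> (\<gamma> / \<epsilon>) K B"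
        proof (rule deviation[OF \<gamma>(1,2) elim(1,3) W B])
          show "norm (B 0) \<le> \<rho>"
            using B0 by (simp add: B_0)
          show "norm (W k 0 - (if k = 1 then B 0 else 0)) \<le> \<epsilon> * N0" if "k \<in> {1..n}" for k
            using init[OF that] by (simp only: B_0 W_0[OF that] W0_def)
        qed
        \<comment> \<open>One factor \<epsilon> comes from the scaling of \<open>y\<close>, the
          other from the size of the deviation. As \<open>displ\<close> is linear,
          \<open>\<epsilon>\<^sup>2 * r\<close> is exactly \<open>y\<close> minus \<epsilon> times
          the displacement of the reference amplitude, which is 0 for modes other than 1.\<close>
        define r where "r k t = displ k t ((W k t - (if k = 1 then B t else 0)) / of_real \<epsilon>)" for k t
        have r: "\<epsilon>\<^sup>2 * r k t = \<epsilon> * displ k t (W k t) - \<epsilon> * displ k t (if k = 1 then B t else 0)" for k t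
        proof -
          have "displ k t (z / of_real \<epsilon>) = displ k t z / \<epsilon>" for z
            unfolding displ_def times_divide_eq_right Im_divide_of_real by simp
          then have "\<epsilon>\<^sup>2 * r k t = \<epsilon> * displ k t (W k t - (if k = 1 then B t else 0))"
            using elim(1) by (simp add: r_def power2_eq_square)
          then show ?thesis
            by (simp add: displ_diff[symmetric] right_diff_distrib)
        qed
        show "\<exists>r. (\<forall>t\<in>{0..\<gamma> / \<epsilon>}.
                y 1 t = \<epsilon> * a (\<epsilon> * t) * cos ((\<omega> 1 + \<epsilon> * \<sigma>) * t + b (\<epsilon> * t)) + \<epsilon>\<^sup>2 * r 1 t \<and>
                (\<forall>k\<in>{1..n}. k \<noteq> 1 \<longrightarrow> y k t = \<epsilon>\<^sup>2 * r k t)) \<and>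
             (\<forall>k\<in>{1..n}. C2_bounded_by Cb {0<..<\<gamma> / \<epsilon>} (r k))"
        proof (intro exI[of _ r] conjI ballI impI)
          fix t assume t: "t \<in> {0..\<gamma> / \<epsilon>}"
          show "y 1 t = \<epsilon> * a (\<epsilon> * t) * cos ((\<omega> 1 + \<epsilon> * \<sigma>) * t + b (\<epsilon> * t)) + \<epsilon>\<^sup>2 * r 1 t"
            unfolding r yW[OF one_mem t] using displ_amplitude[of t \<epsilon> a b] by (simp add: B_def)
          show "y k t = \<epsilon>\<^sup>2 * r k t" if "k \<in> {1..n}" "k \<noteq> 1" for k
            unfolding r yW[OF that(1) t] using that(2) by (simp add: displ_def)
        next
          fix k assume k: "k \<in> {1..n}"
          show "C2_bounded_by Cb {0<..<\<gamma> / \<epsilon>} (r k)"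
            unfolding r_def using dev elim(2) by (intro residual[OF elim(1) _ k W B]) auto
        qed
      qed
    qed
  qed
qed

end

theorem proposition3p3:
  fixes n p :: nat
    and c d \<sigma> abar bbar C1 :: real
    and M K :: "real mat"
    and \<omega> lam f :: "nat \<Rightarrow> real"
    and \<phi> :: "nat \<Rightarrow> real vec"
    and a0 b0 :: "real \<Rightarrow> real"
    and Y0 V0 :: "real \<Rightarrow> nat \<Rightarrow> real"
  assumes "n \<ge> 2" and "p \<in> {2..n}"
    and "sym_pos_def n M" and "sym_pos_def n K"
    and "\<And>k. k \<in> {1..n} \<Longrightarrow> \<omega> k > 0"
    and "\<And>k. k \<in> {1..n} \<Longrightarrow> \<phi> k \<in> carrier_vec n"
    and "\<And>k. k \<in> {1..n} \<Longrightarrow> K *\<^sub>v \<phi> k = (\<omega> k)\<^sup>2 \<cdot>\<^sub>v (M *\<^sub>v \<phi> k)"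
    and "\<And>k l. k \<in> {1..n} \<Longrightarrow> l \<in> {1..n} \<Longrightarrow>
           \<phi> k \<bullet> (M *\<^sub>v \<phi> l) = (if k = l then 1 else 0)"
    and "\<And>k. k \<in> {1..n} \<Longrightarrow> lam k > 0"
    and "\<And>k. k \<in> {1..n} \<Longrightarrow> k \<noteq> 1 \<Longrightarrow> Z_independent (\<omega> k) (\<omega> 1)"
    and "abar \<noteq> 0"
    and "modulation_solution (\<omega> 1) (lam 1) (f 1) \<sigma> d (jump p (\<phi> 1)) {0..} (\<lambda>_. abar) (\<lambda>_. bbar)"
    and "(\<lambda>\<epsilon>. Y0 \<epsilon> 1 - \<epsilon> * a0 \<epsilon> * cos (b0 \<epsilon>)) \<in> O[at_right 0](\<lambda>\<epsilon>. \<epsilon>\<^sup>2)"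
    and "(\<lambda>\<epsilon>. V0 \<epsilon> 1 - (- \<epsilon> * \<omega> 1 * a0 \<epsilon> * sin (b0 \<epsilon>))) \<in> O[at_right 0](\<lambda>\<epsilon>. \<epsilon>\<^sup>2)"
    and "\<And>k. k \<in> {1..n} \<Longrightarrow> k \<noteq> 1 \<Longrightarrow> (\<lambda>\<epsilon>. Y0 \<epsilon> k) \<in> O[at_right 0](\<lambda>\<epsilon>. \<epsilon>\<^sup>2)"
    and "\<And>k. k \<in> {1..n} \<Longrightarrow> k \<noteq> 1 \<Longrightarrow> \<forall>\<^sub>F \<epsilon> in at_right 0. V0 \<epsilon> k = 0"
    and "\<forall>\<^sub>F \<epsilon> in at_right 0. \<bar>a0 \<epsilon> - abar\<bar> \<le> \<epsilon> * C1"
    and "\<forall>\<^sub>F \<epsilon> in at_right 0. \<bar>b0 \<epsilon> - bbar\<bar> \<le> \<epsilon> * C1"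
  shows "\<exists>\<gamma>>0. \<exists>B. \<forall>\<^sub>F \<epsilon> in at_right 0.
    (let \<Omega> = \<omega> 1 + \<epsilon> * \<sigma>;
         is_mod = (\<lambda>a b. modulation_solution (\<omega> 1) (lam 1) (f 1) \<sigma> d (jump p (\<phi> 1)) {0..\<gamma>} a b \<and>
                         a 0 = a0 \<epsilon> \<and> b 0 = b0 \<epsilon>);
         is_sol = modal_solution n \<omega> lam f (\<lambda>k. jump p (\<phi> k)) c d \<epsilon> \<Omega> (Y0 \<epsilon>) (V0 \<epsilon>) (\<gamma> / \<epsilon>)
     in (\<exists>a b. is_mod a b) \<and> (\<exists>y. is_sol y) \<and>
        (\<forall>a b y. is_mod a b \<longrightarrow> is_sol y \<longrightarrow>
          (\<exists>r. (\<forall>t\<in>{0..\<gamma> / \<epsilon>}.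
                  y 1 t = \<epsilon> * a (\<epsilon> * t) * cos (\<Omega> * t + b (\<epsilon> * t)) + \<epsilon>\<^sup>2 * r 1 t \<and>
                  (\<forall>k\<in>{1..n}. k \<noteq> 1 \<longrightarrow> y k t = \<epsilon>\<^sup>2 * r k t)) \<and>
               (\<forall>k\<in>{1..n}. C2_bounded_by B {0<..<\<gamma> / \<epsilon>} (r k)))))"
proof -
  interpret modal_system n \<omega> lam f "\<lambda>k. jump p (\<phi> k)" c d \<sigma>
    using assms(1,5,10) by unfold_locales auto
  show ?thesis
    by (rule multiple_scales_expansion[where ?Y0.0 = Y0 and ?V0.0 = V0 and ?a0.0 = a0 and ?b0.0 = b0,
          OF assms(11,13-17)])
qed

end
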